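(* Let $D>0$, $v\ge 0$, $k\in\mathbb{R}$ be constants with $k>-\frac{v^2}{4D}$, and set $\zeta:=\frac{1}{2D}\sqrt{v^2+4kD}$. Consider the PDE $$\frac{\partial y}{\partial t}(t,z)=D\frac{\partial^2y}{\partial z^2}(t,z)-v\frac{\partial y}{\partial z}(t,z)-ky(t,z),\quad (t,z)\in(0,+\infty)\times(0,1),$$ with one of the following boundary conditions for $t\ge0$: (Case $a=+\infty$) $y(t,0)=d(t)$, $y(t,1)=0$; (Case $0\le a<+\infty$) $y(t,0)=d(t)$, $\frac{\partial y}{\partial z}(t,1)=\left(\frac{v}{2D}-a\right)y(t,1)$. Then for every $d\in C^2(\mathbb{R}_+;\mathbb{R})$ and every $y_0\in C^2([0,1];\mathbb{R})$ with $y_0(0)=d(0)$ and with $y_0(1)=0$ (in the case $a=+\infty$) or $\frac{dy_0}{dz}(1)=\left(\frac{v}{2D}-a\right)y_0(1)$ (in the case $0\le a<+\infty$), the solution of this problem with initial condition $y(0,\cdot)=y_0$ is unique, is defined for all $t\ge0$, and satisfies, for all $t\ge 0$ and $\varepsilon>0$, $$\sqrt{\int_0^1\exp\left(-\frac{vz}{D}\right)y^2(t,z)\,dz}\le\exp\left(-D\left(\zeta^2+\pi^2(1-\mu_1(a))^2\right)t\right)\sqrt{(1+\varepsilon)\int_0^1\exp\left(-\frac{vz}{D}\right)y_0^2(z)\,dz}+\sqrt{1+\varepsilon^{-1}}\,G(\zeta,a)\max_{0\le s\le t}|d(s)| ,$$ where $\mu_1(a)$ and $G(\zeta,a)$ are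 the quantities defined in the context.
   Context: $\mathbb{R}_+=[0,+\infty)$. "Solution" means a function $y\in C^0(\mathbb{R}_+\times[0,1];\mathbb{R})\cap C^1((0,+\infty)\times[0,1];\mathbb{R})$ with $y(t,\cdot)\in C^2([0,1];\mathbb{R})$ for all $t\ge0$, satisfying the boundary conditions for all $t\ge 0$, the PDE on $(0,+\infty)\times(0,1)$ and the initial condition. The numbers $\mu_n(a)\in[0,\frac12]$, $n=1,2,\dots$, are defined by: $\mu_n(+\infty)=0$; for $0<a<+\infty$, $\mu_n(a)\in(0,\frac12)$ is the unique solution of $\tan(\mu_n\pi)+a^{-1}\mu_n\pi=a^{-1}n\pi$; $\mu_n(0)=\frac12$. For $\zeta>0$ and $0\le a<+\infty$, $$G(\zeta,a):=\frac{\sqrt2}{\pi}\sqrt{\sum_{n=1}^\infty\frac{(n-\mu_n(a))^3}{\left((n-\mu_n(a))+(2\pi)^{-1}\sin(2\mu_n(a)\pi)\right)\left(\pi^{-2}\zeta^2+(n-\mu_n(a))^2\right)^2}}=\sqrt{c_1^2\frac{\exp(2\zeta)-1}{2\zeta}+c_2^2\frac{1-\exp(-2\zeta)}{2\zeta}+2c_1c_2},$$ with $c_1=\frac{\zeta-a}{(\zeta+a)\exp(2\zeta)+\zeta-a}$, $c_2=\frac{(\zeta+a)\exp(2\zeta)}{(\zeta+a)\exp(2\zeta)+\zeta-a}$; and $$G(\zeta,+\infty):=\frac{\sqrt2}{\pi}\sqrt{\sum_{n=1}^\infty\frac{n^2}{\left(\pi^{-2}\zeta^2+n^2\right)^2}}=\frac{1}{\exp(2\zeta)-1}\sqrt{\frac{\exp(4\zeta)-1-4\zeta\exp(2\zeta)}{2\zeta}}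 .$$ *)

theory Defs
  imports "HOL-Analysis.Analysis"
begin

text \<open>
  \<open>C\<^sup>2\<close> on a real interval, with one-sided derivatives at those end points that belong to it.
\<close>

definition C2_on :: "real set \<Rightarrow> (real \<Rightarrow> real) \<Rightarrow> bool" where
  "C2_on S f \<longleftrightarrow> (\<exists>f' f''.
      (\<forall>x\<in>S. (f has_real_derivative f' x) (at x within S)) \<and>
      (\<forall>x\<in>S. (f' has_real_derivative f'' x) (at x within S)) \<and>
      continuous_on S f'')"

text \<open>
  \<open>C\<^sup>1\<close> on a product of two intervals: both partial derivatives (one-sided at end points) exist
  and are jointly continuous.
\<close>

definition C1_on_Times :: "real set \<Rightarrow> real set \<Rightarrow> (real \<Rightarrow> real \<Rightarrow> real) \<Rightarrow> bool" where
  "C1_on_Times S T y \<longleftrightarrow> (\<exists>yt yz.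
      (\<forall>t\<in>S. \<forall>z\<in>T. ((\<lambda>s. y s z) has_real_derivative yt t z) (at t within S)) \<and>
      (\<forall>t\<in>S. \<forall>z\<in>T. (y t has_real_derivative yz t z) (at z within T)) \<and>
      continuous_on (S \<times> T) (\<lambda>(t, z). yt t z) \<and>
      continuous_on (S \<times> T) (\<lambda>(t, z). yz t z))"

text \<open>
  The parameter \<open>a\<close> ranges over \<open>[0, +\<infinity>]\<close>; the value \<open>\<infinity>\<close> encodes the Dirichlet condition at
  \<open>z = 1\<close>, finite values the Robin condition.
\<close>

definition right_boundary_condition :: "real \<Rightarrow> real \<Rightarrow> ennreal \<Rightarrow> (real \<Rightarrow> real) \<Rightarrow> bool" where
  "right_boundary_condition D v a f \<longleftrightarrow>
     (if a = \<infinity> then f 1 = 0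
      else (f has_real_derivative (v / (2 * D) - enn2real a) * f 1) (at 1 within {0..1}))"

text \<open>
  The differential equation is only imposed at interior points, where \<open>deriv\<close> denotes the ordinary
  two-sided derivative; its existence there follows from the regularity conditions.
\<close>

definition is_solution ::
  "real \<Rightarrow> real \<Rightarrow> real \<Rightarrow> ennreal \<Rightarrow> (real \<Rightarrow> real) \<Rightarrow> (real \<Rightarrow> real) \<Rightarrow> (real \<Rightarrow> real \<Rightarrow> real) \<Rightarrow> bool"
where
  "is_solution D v k a d y0 y \<longleftrightarrow>
     continuous_on ({0..} \<times> {0..1}) (\<lambda>(t, z). y t z) \<and>
     C1_on_Times {0<..} {0..1} y \<and>
     (\<forall>t\<ge>0. C2_on {0..1} (y t)) \<and>
     (\<forall>t>0. \<forall>z\<in>{0<..<1}.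
        deriv (\<lambda>s. y s z) t = D * deriv (deriv (y t)) z - v * deriv (y t) z - k * y t z) \<and>
     (\<forall>t\<ge>0. y t 0 = d t \<and> right_boundary_condition D v a (y t)) \<and>
     (\<forall>z\<in>{0..1}. y 0 z = y0 z)"

definition mu :: "ennreal \<Rightarrow> nat \<Rightarrow> real" where
  "mu a n =
     (if a = \<infinity> then 0
      else if a = 0 then 1/2
      else THE \<mu>. 0 < \<mu> \<and> \<mu> < 1/2 \<and>
             tan (\<mu> * pi) + \<mu> * pi / enn2real a = real n * pi / enn2real a)"

lemma mu_unique_root:
  assumes "0 < b" "1 \<le> n"
  shows "\<exists>!\<mu>::real. 0 < \<mu> \<and> \<mu> < 1/2 \<and> tan (\<mu> * pi) + \<mu> * pi / b = real n * pi / b"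
proof (rule ex_ex1I)
  define h where "h \<mu> = b * sin (\<mu> * pi) + (\<mu> - real n) * pi * cos (\<mu> * pi)" for \<mu>
  have "\<exists>x\<ge>0. x \<le> 1/2 \<and> h x = 0"
  proof (rule IVT')
    show "h 0 \<le> 0" "0 \<le> h (1/2)" "(0::real) \<le> 1/2"
      using assms by (auto simp: h_def)
    show "continuous_on {0..1/2} h"
      unfolding h_def by (intro continuous_intros)
  qed
  then obtain x where x: "0 \<le> x" "x \<le> 1/2" "h x = 0" by blast
  have "h 0 \<noteq> 0" "h (1/2) \<noteq> 0" using assms by (auto simp: h_def)
  then have "x \<noteq> 0" "x \<noteq> 1/2" using x(3) by metis+
  with x(1,2) have x': "0 < x" "x < 1/2" by linarith+
  have "- (pi / 2) < x * pi"
    by (rule order.strict_trans[of _ 0]) (use x' in auto)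
  then have "cos (x * pi) > 0"
    using x' by (intro cos_gt_zero_pi) auto
  then have "tan (x * pi) + x * pi / b = real n * pi / b"
    using x(3) assms by (simp add: h_def tan_def field_simps)
  with x' show "\<exists>\<mu>::real. 0 < \<mu> \<and> \<mu> < 1/2 \<and> tan (\<mu> * pi) + \<mu> * pi / b = real n * pi / b"
    by blast
next
  fix x y :: real
  have less: "tan (x * pi) + x * pi / b < tan (y * pi) + y * pi / b"
    if "0 < x" "x < y" "y < 1/2" for x y :: real
  proof (rule add_strict_mono)
    have "- (pi / 2) < x * pi"
      by (rule order.strict_trans[of _ 0]) (use that in auto)
    then show "tan (x * pi) < tan (y * pi)"
      using that by (intro tan_monotone) auto
    show "x * pi / b < y * pi / b"
      using that assms by (intro divide_strict_right_mono) auto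
  qed
  assume "0 < x \<and> x < 1/2 \<and> tan (x * pi) + x * pi / b = real n * pi / b"
    and "0 < y \<and> y < 1/2 \<and> tan (y * pi) + y * pi / b = real n * pi / b"
  then show "x = y"
    using less[of x y] less[of y x] by (cases x y rule: linorder_cases) auto
qed

lemma mu_bounds:
  assumes "1 \<le> n"
  shows "0 \<le> mu a n" "mu a n \<le> 1/2"
proof -
  have "0 \<le> mu a n \<and> mu a n \<le> 1/2"
  proof (cases "a = \<infinity> \<or> a = 0")
    case False
    then have "0 < enn2real a"
      by (simp add: enn2real_positive_iff top.not_eq_extremum zero_less_iff_neq_zero)
    from theI'[OF mu_unique_root[OF this assms]] False show ?thesis
      by (simp add: mu_def)
  qed (auto simp: mu_def)
  then show "0 \<le> mu a n" "mu a n \<le> 1/2" by auto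
qed

definition G_term :: "real \<Rightarrow> ennreal \<Rightarrow> nat \<Rightarrow> real" where
  "G_term \<zeta> a n =
     (if a = \<infinity> then (real n)^2 / (\<zeta>^2 / pi^2 + (real n)^2)^2
      else (real n - mu a n)^3 /
             (((real n - mu a n) + sin (2 * mu a n * pi) / (2 * pi)) *
              (\<zeta>^2 / pi^2 + (real n - mu a n)^2)^2))"

text \<open>The sum runs over \<open>n = 1, 2, \<dots>\<close>, hence the index shift.\<close>

definition G :: "real \<Rightarrow> ennreal \<Rightarrow> real" where
  "G \<zeta> a = sqrt 2 / pi * sqrt (\<Sum>n. G_term \<zeta> a (Suc n))"

lemma summable_G_term: "summable (\<lambda>n. G_term \<zeta> a (Suc n))"
proof (rule summable_comparison_test')
  show "summable (\<lambda>n. 4 * (1 / (real (Suc n))^2))"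
    using inverse_squares_sums by (intro summable_mult) (auto simp: sums_iff add.commute)
  fix n :: nat
  define m where "m = real (Suc n) - mu a (Suc n)"
  define s where "s = sin (2 * mu a (Suc n) * pi) / (2 * pi)"
  define q where "q = \<zeta>^2 / pi^2"
  have mu: "0 \<le> mu a (Suc n)" "mu a (Suc n) \<le> 1/2" using mu_bounds[of "Suc n" a] by auto
  have m: "real (Suc n) / 2 \<le> m" "0 < m" using mu by (auto simp: m_def)
  have s: "0 \<le> s" unfolding s_def using mu by (intro divide_nonneg_pos sin_ge_zero) auto
  have q: "0 \<le> q" by (simp add: q_def)
  have G: "G_term \<zeta> a (Suc n) = m^3 / ((m + s) * (q + m^2)^2)"
  proof (cases "a = \<infinity>")
    case True
    then have "m = real (Suc n)" "s = 0" by (auto simp: m_def s_def mu_def)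
    with True show ?thesis
      by (simp add: G_term_def q_def power2_eq_square power3_eq_cube del: of_nat_Suc)
  next
    case False
    then show ?thesis
      by (simp add: G_term_def m_def s_def q_def)
  qed
  have "m * (m^2)^2 \<le> (m + s) * (q + m^2)^2"
    using m s q by (intro mult_mono power_mono) auto
  then have "m^3 / ((m + s) * (q + m^2)^2) \<le> m^3 / (m * (m^2)^2)"
    using m s q by (intro divide_left_mono mult_pos_pos add_pos_nonneg zero_less_power add_nonneg_pos) auto
  also have "\<dots> = 1 / m^2"
    using m by (simp add: power2_eq_square power3_eq_cube)
  also have "\<dots> \<le> 1 / (real (Suc n) / 2)^2"
    using m by (intro divide_left_mono power_mono) (auto simp del: of_nat_Suc)
  also have "\<dots> = 4 * (1 / (real (Suc n))^2)"
    by (simp add: power_divide del: of_nat_Suc)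
  finally show "norm (G_term \<zeta> a (Suc n)) \<le> 4 * (1 / (real (Suc n))^2)"
    using m s q by (simp add: G del: of_nat_Suc)
qed

end

theory Submission
  imports Defs "HOL-Complex_Analysis.Complex_Analysis" "HOL-Real_Asymp.Real_Asymp"
begin

text \<open>
  Put \<open>w(t,z) = exp(-vz/(2D)) y(t,z)\<close>; then \<open>w\<^sub>t = D (w\<^sub>z\<^sub>z - \<zeta>\<^sup>2 w)\<close> with \<open>w(t,0) = d(t)\<close> and a
  homogeneous condition at \<open>z = 1\<close>, and the weighted \<open>L\<^sup>2\<close> norm of \<open>y\<close> is the plain one of \<open>w\<close>.
  The functions \<open>sin(\<omega>\<^sub>n z)\<close>, \<open>\<omega>\<^sub>n = (n - \<mu>\<^sub>n) \<pi>\<close>, are the eigenfunctions of the spatial operator, and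
  the coefficients \<open>c\<^sub>n\<close> of any solution obey \<open>c\<^sub>n' = -D (\<zeta>\<^sup>2 + \<omega>\<^sub>n\<^sup>2) c\<^sub>n + D \<omega>\<^sub>n d\<close>, so
  \<open>|c\<^sub>n(t)|\<close> is at most \<open>exp(-D (\<zeta>\<^sup>2 + \<omega>\<^sub>n\<^sup>2) t) |c\<^sub>n(0)| + \<omega>\<^sub>n / (\<zeta>\<^sup>2 + \<omega>\<^sub>n\<^sup>2) max |d|\<close>. Uniqueness and the
  estimate follow by completeness of the sine system and Parseval's identity; the squares of the
  normalised gains add up to \<open>G(\<zeta>,a)\<^sup>2\<close>.

  Completeness: if \<open>f\<close> is orthogonal to all \<open>sin(\<omega>\<^sub>n z)\<close>, the entire function
  \<open>F(\<lambda>) = \<integral> f(s) sin(\<lambda>s) ds\<close> vanishes at the simple zeros of \<open>\<lambda> cos \<lambda> + a sin \<lambda>\<close>, and the quotient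
  is entire and tends to \<open>0\<close> on a sequence of growing squares; hence \<open>F = 0\<close>.

  Existence: subtract \<open>d \<phi> + d' \<psi>\<close> with \<open>\<phi>'' = \<zeta>\<^sup>2 \<phi>\<close>, \<open>\<phi>(0) = 1\<close> and \<open>D (\<psi>'' - \<zeta>\<^sup>2 \<psi>) = \<phi>\<close>, \<open>\<psi>(0) = 0\<close>.
  The remainder is driven by \<open>- d'' \<psi>\<close> with homogeneous boundary conditions, and its sine series
  may be differentiated term by term for \<open>t > 0\<close>.
\<close>

section \<open>Completeness of the sine systems\<close>

lemma continuous_on_Icc_bound:
  fixes f :: "real \<Rightarrow> real"
  assumes "continuous_on {a..b} f"
  obtains B where "B > 0" "\<And>s. s \<in> {a..b} \<Longrightarrow> \<bar>f s\<bar> \<le> B"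
  using compact_continuous_image[OF assms compact_Icc, THEN compact_imp_bounded]
  unfolding bounded_pos by (metis imageI real_norm_def)

text \<open>
  The addition theorem turns the hypothesis into orthogonality of \<open>f(s) sin(\<pi>s)\<close> to all polynomials
  in \<open>cos(\<pi>s)\<close>, which are dense in the continuous functions on \<open>[0,1]\<close>.
\<close>

lemma sine_system_total:
  fixes f :: "real \<Rightarrow> real"
  assumes cont: "continuous_on {0..1} f"
    and orth: "\<And>n::nat. integral {0..1} (\<lambda>s. f s * sin (real n * pi * s)) = 0"
    and z: "z \<in> {0..1}"
  shows "f z = 0"
proof -
  note [continuous_intros] = cont
  have int: "(\<lambda>s. g s) integrable_on {0..1}" if "continuous_on {0..1} g" for g :: "real \<Rightarrow> real"
    using that by (rule integrable_continuous_real)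
  \<comment> \<open>The index \<open>i\<close> ranges over the integers because the product formula
    for sine times cosine lowers it by one, also past \<open>0\<close>.\<close>
  have moment: "integral {0..1} (\<lambda>s. f s * cos (pi * s)^m * sin (of_int i * pi * s)) = 0" for m and i :: int
  proof (induction m arbitrary: i)
    case 0
    have "integral {0..1} (\<lambda>s. f s * sin (of_int i * pi * s)) = 0"
    proof (cases "i \<ge> 0")
      case True
      then obtain n where "i = int n" using nonneg_eq_int by blast
      then show ?thesis using orth[of n] by simp
    next
      case False
      then have "i = - int (nat (- i))" by simp
      then obtain n where "i = - int n" by blast
      then show ?thesis using orth[of n] by (simp add: integral_neg)
    qed
    then show ?case by simp
  next
    case (Suc m)
    have "f s * cos (pi * s)^Suc m * sin (of_int i * pi * s)
       = 1/2 * (f s * cos (pi * s)^m * sin (of_int (i+1) * pi * s))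
       + 1/2 * (f s * cos (pi * s)^m * sin (of_int (i-1) * pi * s))" for s
    proof -
      have "sin (of_int (i+1) * pi * s) + sin (of_int (i-1) * pi * s)
          = 2 * (sin (of_int i * pi * s) * cos (pi * s))"
        by (simp add: ring_distribs sin_add sin_diff)
      moreover have "g * c^Suc m * x = 1/2 * (g * c^m * y) + 1/2 * (g * c^m * y')"
        if "y + y' = 2 * (x * c)" for c g x y y' :: real
      proof -
        have "1/2 * (g * c^m * y) + 1/2 * (g * c^m * y') = 1/2 * (g * c^m * (y + y'))"
          by (simp only: ring_distribs)
        then show ?thesis by (simp add: that)
      qed
      ultimately show ?thesis by blast
    qed
    then have "integral {0..1} (\<lambda>s. f s * cos (pi * s)^Suc m * sin (of_int i * pi * s))
      = integral {0..1} (\<lambda>s. 1/2 * (f s * cos (pi * s)^m * sin (of_int (i+1) * pi * s))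
       + 1/2 * (f s * cos (pi * s)^m * sin (of_int (i-1) * pi * s)))" by presburger
    also have "\<dots> = 0"
      by (subst integral_add) (auto simp only: integral_mult_right Suc.IH intro!: int continuous_intros)
    finally show ?case .
  qed
  have poly0: "integral {0..1} (\<lambda>s. f s * p (cos (pi * s)) * sin (pi * s)) = 0"
    if "real_polynomial_function p" for p
  proof -
    obtain c n where p: "p = (\<lambda>x. \<Sum>i\<le>n. c i * x^i)"
      using \<open>real_polynomial_function p\<close> unfolding real_polynomial_function_iff_sum by blast
    have "integral {0..1} (\<lambda>s. f s * p (cos (pi * s)) * sin (pi * s))
        = integral {0..1} (\<lambda>s. \<Sum>i\<le>n. c i * (f s * cos (pi * s)^i * sin (of_int 1 * pi * s)))"
      by (simp add: p sum_distrib_left sum_distrib_right mult_ac)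
    also have "\<dots> = (\<Sum>i\<le>n. integral {0..1} (\<lambda>s. c i * (f s * cos (pi * s)^i * sin (of_int 1 * pi * s))))"
      by (rule integral_sum) (auto intro!: int continuous_intros)
    also have "\<dots> = 0" by (simp only: integral_mult_right moment) simp
    finally show ?thesis .
  qed
  \<comment> \<open>\<open>J\<close> pairs \<open>f\<close> with itself against a weight that is
    positive inside the interval. By \<open>poly0\<close>, replacing one factor \<open>f\<close> by
    a polynomial in \<open>cos (pi * s)\<close> gives integral 0, so \<open>J\<close> is as small as
    the approximation error.\<close>
  define J where "J = integral {0..1} (\<lambda>s. f s ^ 2 * sin (pi * s))"
  obtain B where B: "\<And>s. s \<in> {0..1} \<Longrightarrow> \<bar>f s\<bar> \<le> B" "B > 0"
    using continuous_on_Icc_bound[OF cont] by metis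
  have "\<bar>J\<bar> \<le> B * e" if "e > 0" for e
  proof -
    \<comment> \<open>The substitution \<open>x = cos (pi * s)\<close> maps [0,1] bijectively onto
      [-1,1], which brings Weierstrass approximation by ordinary polynomials into play.\<close>
    have "continuous_on {-1..1} (\<lambda>x. f (arccos x / pi))"
      by (intro continuous_on_compose2[OF cont, where f="\<lambda>x. arccos x / pi"] continuous_intros)
        (auto simp: arccos_lbound arccos_ubound field_simps)
    from Stone_Weierstrass_real_polynomial_function[OF _ this \<open>e > 0\<close>]
    obtain p where p: "real_polynomial_function p" "\<And>x. x \<in> {-1..1} \<Longrightarrow> \<bar>f (arccos x / pi) - p x\<bar> < e"
      by auto
    have contp: "continuous_on A p" for A
      using p(1) continuous_on_polymonial_function real_polynomial_function_eq by blast
    have close: "\<bar>f s - p (cos (pi * s))\<bar> < e" if "s \<in> {0..1}" for s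
      using p(2)[of "cos (pi * s)"] that by (simp add: arccos_cos field_simps)
    have "J = integral {0..1} (\<lambda>s. f s ^ 2 * sin (pi * s)) - integral {0..1} (\<lambda>s. f s * p (cos (pi * s)) * sin (pi * s))"
      using poly0[OF p(1)] by (simp add: J_def)
    also have "\<dots> = integral {0..1} (\<lambda>s. f s ^ 2 * sin (pi * s) - f s * p (cos (pi * s)) * sin (pi * s))"
      by (rule integral_diff[symmetric]) (intro int continuous_intros continuous_on_compose2[OF contp[of UNIV]]; simp)+
    also have "\<dots> = integral {0..1} (\<lambda>s. f s * (f s - p (cos (pi * s))) * sin (pi * s))"
      by (simp add: algebra_simps power2_eq_square)
    also have "norm \<dots> \<le> (B * e) * (1 - 0)"
    proof (rule integral_bound)
      fix s :: real assume s: "s \<in> {0..1}"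
      have "\<bar>f s\<bar> * \<bar>f s - p (cos (pi * s))\<bar> * \<bar>sin (pi * s)\<bar> \<le> B * e * 1"
        using B(1)[OF s] B(2) close[OF s] \<open>e > 0\<close> by (intro mult_mono) (auto intro: less_imp_le)
      then show "norm (f s * (f s - p (cos (pi * s))) * sin (pi * s)) \<le> B * e"
        by (simp add: abs_mult)
    qed (auto intro!: continuous_intros continuous_on_compose2[OF contp[of UNIV]])
    finally show ?thesis by simp
  qed
  \<comment> \<open>With this \<open>e\<close>, a nonzero \<open>J\<close> would satisfy |J| <= |J|
    / 2.\<close>
  from this[of "\<bar>J\<bar> / (2 * B)"] have "J = 0" using \<open>B > 0\<close> by (auto simp: field_simps)
  have nonneg: "0 \<le> f s ^ 2 * sin (pi * s)" if "s \<in> {0..1}" for s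
    using that by (intro mult_nonneg_nonneg sin_ge_zero) auto
  have zero: "f s ^ 2 * sin (pi * s) = 0" if "s \<in> {0..1}" for s
  proof -
    have "continuous_on {0..1} (\<lambda>s. f s ^ 2 * sin (pi * s))" by (intro continuous_intros)
    then show ?thesis
      using \<open>J = 0\<close> integral_eq_0_iff[of 0 1 "\<lambda>s. f s ^ 2 * sin (pi * s)"] nonneg that
      unfolding J_def by simp
  qed
  \<comment> \<open>The weight vanishes at both end points; there the claim follows by continuity of
    \<open>f\<close>.\<close>
  have "f s = 0" if "s \<in> {0<..<1}" for s
    using zero[of s] sin_gt_zero[of "pi * s"] that by auto
  then show ?thesis
    using continuous_constant_on_closure[of "{0<..<1::real}" f 0 z] cont z by auto
qed

section \<open>Entire functions: division at simple zeros and decay on growing squares\<close>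

lemma entire_simple_zero_quotient:
  fixes F E :: "complex \<Rightarrow> complex"
  assumes F: "F holomorphic_on UNIV" and E: "E holomorphic_on UNIV"
    and zero: "\<And>z. E z = 0 \<Longrightarrow> F z = 0" and simple: "\<And>z. E z = 0 \<Longrightarrow> deriv E z \<noteq> 0"
  obtains Q where "Q holomorphic_on UNIV" "\<And>z. F z = Q z * E z"
proof
  define Q where "Q z = (if E z = 0 then deriv F z / deriv E z else F z / E z)" for z
  show "F z = Q z * E z" for z using zero by (simp add: Q_def)
  show "Q holomorphic_on UNIV"
    unfolding holomorphic_on_def
  proof
    fix z0 :: complex
    show "Q field_differentiable (at z0)"
    proof (cases "E z0 = 0")
      case False
      have "open {z. E z \<noteq> 0}"
        using holomorphic_on_imp_continuous_on[OF E] by (intro open_Collect_neq) auto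
      moreover have "(\<lambda>z. F z / E z) holomorphic_on {z. E z \<noteq> 0}"
        by (intro holomorphic_on_divide holomorphic_on_subset[OF F] holomorphic_on_subset[OF E]) auto
      then have "Q holomorphic_on {z. E z \<noteq> 0}"
        by (rule holomorphic_transform) (simp add: Q_def)
      ultimately show ?thesis using False by (auto simp: holomorphic_on_open field_differentiable_def)
    next
      case True
      \<comment> \<open>\<open>F1\<close> and \<open>E1\<close> are the difference quotients at
        \<open>z0\<close> with the removable singularity filled in. As
        \<open>F z0 = E z0 = 0\<close>, their ratio is \<open>Q\<close> wherever \<open>E1\<close>
        is nonzero, and simplicity of the zero makes \<open>E1 z0\<close> nonzero.\<close>
      define F1 where "F1 z = (if z = z0 then deriv F z0 else (F z - F z0) / (z - z0))" for z
      define E1 where "E1 z = (if z = z0 then deriv E z0 else (E z - E z0) / (z - z0))" for z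
      have hol: "F1 holomorphic_on UNIV" "E1 holomorphic_on UNIV"
        unfolding F1_def[abs_def] E1_def[abs_def] using F E by (auto intro: pole_lemma_open)
      have op: "open {z. E1 z \<noteq> 0}"
        using holomorphic_on_imp_continuous_on[OF hol(2)] by (intro open_Collect_neq) auto
      have "(\<lambda>z. F1 z / E1 z) holomorphic_on {z. E1 z \<noteq> 0}"
        by (intro holomorphic_on_divide holomorphic_on_subset[OF hol(1)] holomorphic_on_subset[OF hol(2)]) auto
      then have "Q holomorphic_on {z. E1 z \<noteq> 0}"
        by (rule holomorphic_transform)
          (use True zero[OF True] in \<open>auto simp: Q_def F1_def E1_def\<close>)
      moreover have "E1 z0 \<noteq> 0" using simple[OF True] by (simp add: E1_def)
      ultimately show ?thesis using op by (auto simp: holomorphic_on_open field_differentiable_def)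
    qed
  qed
qed

text \<open>A relative of Liouville's theorem: once the square of half-side \<open>R n\<close>
  contains \<open>z\<close>, the maximum modulus principle carries the bound \<open>b n\<close> from
  its boundary to \<open>z\<close>, and \<open>b n\<close> tends to 0.\<close>

lemma entire_vanishing_on_squares:
  fixes Q :: "complex \<Rightarrow> complex"
  assumes Q: "Q holomorphic_on UNIV"
    and R: "filterlim R at_top sequentially"
    and b: "b \<longlonglongrightarrow> (0::real)"
    and bound: "\<And>n z. \<bar>Re z\<bar> = R n \<or> \<bar>Im z\<bar> = R n \<Longrightarrow> norm (Q z) \<le> b n"
  shows "Q z = 0"
proof -
  have "\<forall>\<^sub>F n in sequentially. norm (Q z) \<le> b n"
    using R[unfolded filterlim_at_top, rule_format, of "\<bar>Re z\<bar> + \<bar>Im z\<bar> + 1"]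
  proof eventually_elim
    case (elim n)
    define S where "S = cbox (Complex (- R n) (- R n)) (Complex (R n) (R n))"
    show ?case
    proof (rule maximum_modulus_frontier[of Q S])
      show "Q holomorphic_on interior S" using Q holomorphic_on_subset by blast
      show "continuous_on (closure S) Q"
        using holomorphic_on_imp_continuous_on[OF Q] continuous_on_subset by blast
      show "bounded S" by (simp add: S_def bounded_cbox)
      show "z \<in> S" using elim by (auto simp: S_def in_cbox_complex_iff)
      fix w assume "w \<in> frontier S"
      then have "w \<in> S" "w \<notin> box (Complex (- R n) (- R n)) (Complex (R n) (R n))"
        by (auto simp: S_def frontier_def)
      then have "\<bar>Re w\<bar> = R n \<or> \<bar>Im w\<bar> = R n"
        by (auto simp: S_def in_cbox_complex_iff in_box_complex_iff)
      then show "norm (Q w) \<le> b n" by (rule bound)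
    qed
  qed
  then have "norm (Q z) \<le> 0"
    using b by (intro tendsto_lowerbound[OF b]) auto
  then show ?thesis by simp
qed

section \<open>The characteristic function \<open>z * cos z + a * sin z\<close>\<close>

lemma norm_sin_cos_le_exp:
  "norm (sin z) \<le> exp \<bar>Im z\<bar>" "norm (cos z) \<le> exp \<bar>Im z\<bar>" for z :: complex
proof -
  have e: "norm (exp (\<i> * z)) \<le> exp \<bar>Im z\<bar>" "norm (exp (- (\<i> * z))) \<le> exp \<bar>Im z\<bar>"
    by (simp_all add: norm_exp_eq_Re)
  note [simp del] = norm_exp_eq_Re
  show "norm (sin z) \<le> exp \<bar>Im z\<bar>"
    using norm_triangle_ineq4[of "exp (\<i> * z)" "exp (- (\<i> * z))"] e
    by (simp add: sin_exp_eq norm_divide norm_mult)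
  show "norm (cos z) \<le> exp \<bar>Im z\<bar>"
    using norm_triangle_ineq[of "exp (\<i> * z)" "exp (- (\<i> * z))"] e
    by (simp add: cos_exp_eq norm_divide norm_mult)
qed

lemma Re_Im_sin_cos_hyperbolic:
  "Re (sin z) = sin (Re z) * cosh (Im z)" "Im (sin z) = cos (Re z) * sinh (Im z)"
  "Re (cos z) = cos (Re z) * cosh (Im z)" "Im (cos z) = - (sin (Re z) * sinh (Im z))"
  by (simp_all add: Re_sin Im_sin Re_cos Im_cos cosh_def sinh_def field_simps)

text \<open>On the vertical lines \<open>sin (Re z) = 0\<close>, so \<open>cos z\<close> is real,
  \<open>sin z\<close> is imaginary, and the real part alone is large. On the horizontal lines |cos
  z| is at least a quarter of the exponential, and the sine term costs at most \<open>a\<close>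
  times it.\<close>

lemma robin_char_lower_bound:
  fixes z :: complex and a :: real
  assumes a: "a \<ge> 0" and n: "n > 0" and z: "\<bar>Re z\<bar> = real n * pi \<or> \<bar>Im z\<bar> = real n * pi"
  shows "exp \<bar>Im z\<bar> * (real n * pi / 4 - a) \<le> norm (z * cos z + of_real a * sin z)"
proof -
  define y where "y = Im z"
  have np: "real n * pi \<ge> 3" using n pi_gt3 mult_mono[of 1 "real n" 3 pi] by simp
  from z show ?thesis
  proof
    assume re: "\<bar>Re z\<bar> = real n * pi"
    have s: "sin (Re z) = 0" 
      using re sin_npi[of n] sin_minus[of "Re z"] by (cases "Re z < 0") auto
    have c: "\<bar>cos (Re z)\<bar> = 1" using s sin_cos_squared_add[of "Re z"] by (auto simp: power2_eq_1_iff)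
    have "cos z = of_real (cos (Re z) * cosh y)" "sin z = \<i> * of_real (cos (Re z) * sinh y)"
      using s by (auto simp: complex_eq_iff y_def Re_Im_sin_cos_hyperbolic)
    then have "Re (z * cos z + of_real a * sin z) = Re z * (cos (Re z) * cosh y)" by simp
    then have "real n * pi * cosh y \<le> norm (z * cos z + of_real a * sin z)"
      using abs_Re_le_cmod[of "z * cos z + of_real a * sin z"] re c by (simp add: abs_mult)
    moreover have "exp \<bar>y\<bar> \<le> 2 * cosh y" by (auto simp: cosh_def abs_if)
    then have "exp \<bar>y\<bar> * (real n * pi / 4) \<le> (2 * cosh y) * (real n * pi / 2)"
      using np by (intro mult_mono) auto
    then have "exp \<bar>y\<bar> * (real n * pi / 4) \<le> real n * pi * cosh y" by (simp add: mult_ac)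
    moreover have "exp \<bar>y\<bar> * (real n * pi / 4 - a) \<le> exp \<bar>y\<bar> * (real n * pi / 4)"
      using a by (intro mult_left_mono) auto
    ultimately show ?thesis unfolding y_def by linarith
  next
    assume im: "\<bar>Im z\<bar> = real n * pi"
    have "norm (exp (\<i> * z)) = exp (- y)" "norm (exp (- (\<i> * z))) = exp y"
      by (auto simp: norm_exp_eq_Re y_def)
    then have "exp \<bar>y\<bar> - exp (- \<bar>y\<bar>) \<le> norm (exp (\<i> * z) + exp (- (\<i> * z)))"
      using norm_diff_ineq[of "exp (\<i> * z)" "exp (- (\<i> * z))"]
        norm_diff_ineq[of "exp (- (\<i> * z))" "exp (\<i> * z)"] by (auto simp: abs_if add.commute)
    also have "\<dots> = 2 * norm (cos z)" by (simp add: cos_exp_eq norm_divide)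
    finally have "exp \<bar>y\<bar> - exp (- \<bar>y\<bar>) \<le> 2 * norm (cos z)" .
    moreover have "exp (- \<bar>y\<bar>) \<le> exp \<bar>y\<bar> / 2"
    proof -
      have "2 \<le> exp \<bar>y\<bar>" using exp_ge_add_one_self[of "\<bar>y\<bar>"] im np unfolding y_def by linarith
      moreover have "exp (- \<bar>y\<bar>) \<le> 1" by simp
      ultimately show ?thesis by linarith
    qed
    ultimately have c: "exp \<bar>y\<bar> / 4 \<le> norm (cos z)" by linarith
    have "real n * pi * (exp \<bar>y\<bar> / 4) \<le> norm z * norm (cos z)"
      using im abs_Im_le_cmod[of z] c by (intro mult_mono) auto
    moreover have "a * norm (sin z) \<le> a * exp \<bar>y\<bar>"
      using a norm_sin_cos_le_exp(1)[of z] by (intro mult_left_mono) (auto simp: y_def)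
    moreover have "norm z * norm (cos z) - a * norm (sin z) \<le> norm (z * cos z + of_real a * sin z)"
      using norm_diff_ineq[of "z * cos z" "of_real a * sin z"] a by (simp add: norm_mult)
    ultimately show ?thesis by (simp add: y_def algebra_simps)
  qed
qed

text \<open>Multiply the equation by the conjugate of \<open>cos z\<close> and take imaginary parts:
  the two resulting terms both carry the sign of \<open>Im z\<close>, and the first is nonzero off
  the real axis.\<close>

lemma robin_char_real_zeros:
  fixes z :: complex and a :: real
  assumes a: "a \<ge> 0" and z: "z * cos z + of_real a * sin z = 0"
  shows "Im z = 0"
proof (rule ccontr)
  assume y: "Im z \<noteq> 0"
  have c: "cos z \<noteq> 0"
    using y sin_cos_squared_add[of "Re z"]
    by (auto simp del: sin_cos_squared_add simp: complex_eq_iff Re_Im_sin_cos_hyperbolic)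
  have "Im ((z * cos z + of_real a * sin z) * cnj (cos z)) = 0" using z by simp
  moreover have "Im ((z * cos z + of_real a * sin z) * cnj (cos z))
     = Im z * (norm (cos z))^2 + a * (sinh (Im z) * cosh (Im z) * ((sin (Re z))^2 + (cos (Re z))^2))"
    unfolding cmod_power2 by (simp del: sin_cos_squared_add sin_cos_squared_add2 sin_cos_squared_add3 add: Re_Im_sin_cos_hyperbolic algebra_simps power2_eq_square)
  ultimately have 0: "Im z * (norm (cos z))^2 + a * (sinh (Im z) * cosh (Im z)) = 0" by simp
  show False
  proof (cases "Im z > 0")
    case True
    have "Im z * (norm (cos z))^2 > 0" using True c by simp
    moreover have "a * (sinh (Im z) * cosh (Im z)) \<ge> 0" using True a by simp
    ultimately show False using 0 by linarith
  next
    case False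
    have "Im z * (norm (cos z))^2 < 0" using False y c by (intro mult_neg_pos) auto
    moreover have "a * (sinh (Im z) * cosh (Im z)) \<le> 0" using False a
      by (intro mult_nonneg_nonpos mult_nonpos_nonneg) auto
    ultimately show False using 0 by linarith
  qed
qed

text \<open>If the function and its derivative both vanished, \<open>x\<close> times the first plus
  \<open>a\<close> times the second would give \<open>cos x * (x^2 + a + a^2) = 0\<close>. Either
  factor being 0 contradicts the vanishing of the derivative.\<close>

lemma robin_char_simple_zeros:
  fixes x a :: real
  assumes a: "a \<ge> 0" and x: "x * cos x + a * sin x = 0"
  shows "cos x - x * sin x + a * cos x \<noteq> 0"
proof
  assume d: "cos x - x * sin x + a * cos x = 0"
  have "x * (x * cos x + a * sin x) + a * (cos x - x * sin x + a * cos x)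
      = cos x * (x^2 + a + a^2)" by (simp add: algebra_simps power2_eq_square)
  with x d have "cos x * (x^2 + a + a^2) = 0" by simp
  moreover have "cos x \<noteq> 0"
  proof
    assume c: "cos x = 0"
    then have "sin x \<noteq> 0" using sin_cos_squared_add[of x] by auto
    with d c have "x = 0" by simp
    with c show False by simp
  qed
  ultimately have "x^2 + a + a^2 = 0" by simp
  then have "x = 0" "a = 0" using a by (auto simp: add_nonneg_eq_0_iff add.assoc)
  with d show False by simp
qed

text \<open>Orthogonality is assumed for every positive root of the characteristic equation; that
  the frequencies built from \<open>mu\<close> exhaust these roots is shown separately in
  \<open>robin_frequency_exists\<close>.\<close>

lemma robin_system_total:
  fixes f :: "real \<Rightarrow> real" and a :: real
  assumes cont: "continuous_on {0..1} f" and a: "a \<ge> 0"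
    and orth: "\<And>x. x > 0 \<Longrightarrow> x * cos x + a * sin x = 0 \<Longrightarrow> integral {0..1} (\<lambda>s. f s * sin (x * s)) = 0"
    and z: "z \<in> {0..1}"
  shows "f z = 0"
proof -
  define F where "F l = integral {0..1} (\<lambda>s. of_real (f s) * sin (l * of_real s))" for l :: complex
  define E where "E l = l * cos l + of_real a * sin l" for l :: complex
  have cof: "continuous_on {0..1} (\<lambda>s. complex_of_real (f s))"
    using cont by (intro continuous_intros)
  have F_real: "F (of_real x) = of_real (integral {0..1} (\<lambda>s. f s * sin (x * s)))" for x
  proof -
    have "((\<lambda>s. f s * sin (x * s)) has_integral integral {0..1} (\<lambda>s. f s * sin (x * s))) {0..1}"
      by (intro integrable_integral integrable_continuous_real continuous_intros cont)
    from has_integral_of_real[OF this, where 'b=complex] show ?thesis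
      unfolding F_def by (intro integral_unique) (simp flip: of_real_mult add: sin_of_real)
  qed
  have holF: "F holomorphic_on UNIV"
  proof -
    have "continuous_on (UNIV \<times> cbox 0 1) (\<lambda>(l, s). of_real (f s) * (cos (l * of_real s) * of_real s) :: complex)"
      unfolding split_beta
      by (intro continuous_intros continuous_on_compose2[OF cof]) auto
    then show ?thesis
      unfolding F_def[abs_def] interval_cbox
      by (intro leibniz_rule_holomorphic[where fx = "\<lambda>l s. of_real (f s) * (cos (l * of_real s) * of_real s)"]
          integrable_continuous continuous_on_mult cof[unfolded interval_cbox])
        (auto intro!: derivative_eq_intros continuous_intros)
  qed
  have holE: "E holomorphic_on UNIV" unfolding E_def by (intro holomorphic_intros)
  have Ereal: "E (of_real x) = of_real (x * cos x + a * sin x)" for x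
    by (simp add: E_def cos_of_real sin_of_real)
  have real_zero: "\<exists>x. l = of_real x \<and> x * cos x + a * sin x = 0" if "E l = 0" for l
  proof -
    have "l = of_real (Re l)"
      using robin_char_real_zeros[OF a] that by (auto simp: E_def complex_eq_iff)
    then show ?thesis using that Ereal[of "Re l"] by (metis of_real_eq_0_iff)
  qed
  have FE: "F l = 0" if l: "E l = 0" for l
  proof -
    obtain x where x: "l = of_real x" "x * cos x + a * sin x = 0" using real_zero[OF l] by blast
    \<comment> \<open>Negative roots are covered by oddness of the sine, and the root 0 is
      trivial.\<close>
    have "integral {0..1} (\<lambda>s. f s * sin (x * s)) = 0"
    proof (cases x "0::real" rule: linorder_cases)
      case less
      with orth[of "- x"] x(2) show ?thesis by simp
    qed (use orth x in auto)
    then show ?thesis using F_real x by simp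
  qed
  have dE: "deriv E l \<noteq> 0" if l: "E l = 0" for l
  proof -
    obtain x where x: "l = of_real x" "x * cos x + a * sin x = 0" using real_zero[OF l] by blast
    have "(E has_field_derivative (cos l - l * sin l + of_real a * cos l)) (at l)"
      unfolding E_def by (auto intro!: derivative_eq_intros)
    then have "deriv E l = of_real (cos x - x * sin x + a * cos x)"
      by (simp add: DERIV_imp_deriv x cos_of_real sin_of_real)
    then show ?thesis using robin_char_simple_zeros[OF a x(2)] by (metis of_real_eq_0_iff)
  qed
  obtain Q where Q: "Q holomorphic_on UNIV" "\<And>l. F l = Q l * E l"
    using entire_simple_zero_quotient[OF holF holE FE dE] by blast
  obtain B where B: "\<And>s. s \<in> {0..1} \<Longrightarrow> \<bar>f s\<bar> \<le> B" "B > 0"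
    using continuous_on_Icc_bound[OF cont] by metis
  have Fbound: "norm (F l) \<le> B * exp \<bar>Im l\<bar>" for l
  proof -
    have "norm (F l) \<le> B * exp \<bar>Im l\<bar> * (1 - 0)"
      unfolding F_def
    proof (rule integral_bound)
      fix s :: real assume s: "s \<in> {0..1}"
      have "\<bar>Im l\<bar> * \<bar>s\<bar> \<le> \<bar>Im l\<bar>" using s by (intro mult_left_le) auto
      then have "norm (sin (l * of_real s)) \<le> exp \<bar>Im l\<bar>"
        using order.trans[OF norm_sin_cos_le_exp(1)[of "l * of_real s"], of "exp \<bar>Im l\<bar>"]
        by (simp add: abs_mult)
      then show "norm (of_real (f s) * sin (l * of_real s)) \<le> B * exp \<bar>Im l\<bar>"
        using B(1)[OF s] B(2) unfolding norm_mult by (intro mult_mono) auto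
    qed (auto intro!: continuous_intros cof)
    then show ?thesis by simp
  qed
  \<comment> \<open>Skipping the first \<open>N\<close> squares makes the factor
    \<open>R n / 4 - a\<close> of the lower bound positive on all the others.\<close>
  obtain N :: nat where N: "real N > 4 * (a + 1)" using reals_Archimedean2 by blast
  define R where "R n = real (Suc (n + N)) * pi" for n
  have R: "filterlim R at_top sequentially"
    unfolding R_def by real_asymp
  have Rbig: "R n / 4 - a > 0" for n
  proof -
    have "4 * (a + 1) * 1 \<le> R n" unfolding R_def using N pi_gt3 a by (intro mult_mono) auto
    then show ?thesis by simp
  qed
  have b: "(\<lambda>n. B / (R n / 4 - a)) \<longlonglongrightarrow> 0"
    unfolding R_def by real_asymp
  have "Q l = 0" for l
  proof (rule entire_vanishing_on_squares[OF Q(1) R b])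
    fix n w assume w: "\<bar>Re w\<bar> = R n \<or> \<bar>Im w\<bar> = R n"
    \<comment> \<open>The same exponential bounds \<open>F\<close> from above and \<open>E\<close>
      from below, so it cancels in the quotient.\<close>
    have "norm (Q w) * (exp \<bar>Im w\<bar> * (R n / 4 - a)) \<le> norm (Q w) * norm (E w)"
      using robin_char_lower_bound[OF a, of "Suc (n + N)" w] w
      by (intro mult_left_mono) (auto simp: E_def R_def)
    also have "\<dots> \<le> B * exp \<bar>Im w\<bar>" using Fbound[of w] Q(2)[of w] by (simp add: norm_mult)
    finally have "norm (Q w) * (R n / 4 - a) * exp \<bar>Im w\<bar> \<le> B * exp \<bar>Im w\<bar>" by (simp only: mult_ac)
    then show "norm (Q w) \<le> B / (R n / 4 - a)"
      using Rbig[of n] by (simp only: pos_le_divide_eq mult_le_cancel_right_pos exp_gt_zero)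
  qed
  then have "F l = 0" for l using Q(2) by simp
  \<comment> \<open>The values of \<open>F = 0\<close> at the multiples of pi are the ordinary sine
    coefficients of \<open>f\<close>, which reduces the claim to the Dirichlet system.\<close>
  then have "integral {0..1} (\<lambda>s. f s * sin (real n * pi * s)) = 0" for n
    using F_real[of "real n * pi"] by simp
  from sine_system_total[OF cont this z] show ?thesis .
qed

section \<open>Sine coefficients and Parseval\<close>

text \<open>The derivatives are arguments, unlike in \<open>C2_on\<close>, so that boundary
  conditions and the equation can refer to the one-sided derivatives.\<close>

definition C2_triple :: "(real \<Rightarrow> real) \<Rightarrow> (real \<Rightarrow> real) \<Rightarrow> (real \<Rightarrow> real) \<Rightarrow> bool" where
  "C2_triple f f' f'' \<longleftrightarrow>
     (\<forall>z\<in>{0..1}. (f has_real_derivative f' z) (at z within {0..1})) \<and>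
     (\<forall>z\<in>{0..1}. (f' has_real_derivative f'' z) (at z within {0..1})) \<and>
     continuous_on {0..1} f''"

lemma C2_triple_continuous:
  assumes "C2_triple f f' f''"
  shows "continuous_on {0..1} f" "continuous_on {0..1} f'" "continuous_on {0..1} f''"
  using assms unfolding C2_triple_def by (meson DERIV_continuous_on)+

lemma C2_triple_add:
  assumes "C2_triple f f' f''" "C2_triple g g' g''"
  shows "C2_triple (\<lambda>z. f z + g z) (\<lambda>z. f' z + g' z) (\<lambda>z. f'' z + g'' z)"
  using assms unfolding C2_triple_def by (auto intro!: derivative_intros continuous_intros)

lemma C2_triple_cmult:
  assumes "C2_triple f f' f''"
  shows "C2_triple (\<lambda>z. c * f z) (\<lambda>z. c * f' z) (\<lambda>z. c * f'' z)"
  using assms unfolding C2_triple_def by (auto intro!: derivative_eq_intros continuous_intros)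

lemma C2_triple_diff:
  assumes "C2_triple f f' f''" "C2_triple g g' g''"
  shows "C2_triple (\<lambda>z. f z - g z) (\<lambda>z. f' z - g' z) (\<lambda>z. f'' z - g'' z)"
  using assms unfolding C2_triple_def by (auto intro!: derivative_intros continuous_intros)

lemma C2_triple_sin: "C2_triple (\<lambda>z. sin (w * z)) (\<lambda>z. w * cos (w * z)) (\<lambda>z. - (w^2) * sin (w * z))"
  unfolding C2_triple_def
  by (auto intro!: derivative_eq_intros continuous_intros simp: power2_eq_square)

definition sin_coef :: "(real \<Rightarrow> real) \<Rightarrow> real \<Rightarrow> real" where
  "sin_coef f w = integral {0..1} (\<lambda>z. f z * sin (w * z))"

lemma sin_coef_diff:
  assumes "continuous_on {0..1} f" "continuous_on {0..1} g"
  shows "sin_coef (\<lambda>z. f z - g z) w = sin_coef f w - sin_coef g w"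
  unfolding sin_coef_def left_diff_distrib
  by (intro integral_diff integrable_continuous_real continuous_intros assms)

lemma sin_coef_cmult: "sin_coef (\<lambda>z. c * f z) w = c * sin_coef f w"
  unfolding sin_coef_def by (simp add: mult.assoc)

lemma sin_coef_cong:
  assumes "\<And>z. z \<in> {0<..<1} \<Longrightarrow> f z = g z"
  shows "sin_coef f w = sin_coef g w"
  unfolding sin_coef_def
  by (rule integral_spike[of "{0,1}"]) (use assms in auto)

lemma abs_sin_coef_le:
  assumes "continuous_on {0..1} f" "\<And>z. z \<in> {0..1} \<Longrightarrow> \<bar>f z\<bar> \<le> B"
  shows "\<bar>sin_coef f w\<bar> \<le> B"
proof -
  have "norm (sin_coef f w) \<le> B * (1 - 0)"
    unfolding sin_coef_def
  proof (rule integral_bound)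
    fix z :: real assume "z \<in> {0..1}"
    from assms(2)[OF this] have "\<bar>f z\<bar> * \<bar>sin (w * z)\<bar> \<le> B * 1" by (intro mult_mono) auto
    then show "norm (f z * sin (w * z)) \<le> B" by (simp add: abs_mult)
  qed (auto intro!: continuous_intros assms)
  then show ?thesis by simp
qed

text \<open>Two integrations by parts at once: \<open>f' * sin - w * f * cos\<close> is an
  antiderivative of \<open>f'' * sin + w^2 * f * sin\<close>.\<close>

lemma sin_coef_second_derivative:
  assumes "C2_triple f f' f''"
  shows "sin_coef f'' w = f' 1 * sin w - w * (f 1 * cos w - f 0) - w^2 * sin_coef f w"
proof -
  have "((\<lambda>z. f' z * sin (w * z) - w * (f z * cos (w * z))) has_real_derivative
      f'' z * sin (w * z) + w^2 * (f z * sin (w * z))) (at z within {0..1})" if "z \<in> {0..1}" for z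
    using assms that unfolding C2_triple_def
    by (auto intro!: derivative_eq_intros simp: power2_eq_square algebra_simps)
  then have "((\<lambda>z. f'' z * sin (w * z) + w^2 * (f z * sin (w * z))) has_integral
      (f' 1 * sin (w * 1) - w * (f 1 * cos (w * 1))) - (f' 0 * sin (w * 0) - w * (f 0 * cos (w * 0)))) {0..1}"
    by (intro fundamental_theorem_of_calculus) (auto simp flip: has_real_derivative_iff_has_vector_derivative)
  then have "integral {0..1} (\<lambda>z. f'' z * sin (w * z) + w^2 * (f z * sin (w * z)))
    = f' 1 * sin w - w * (f 1 * cos w) + w * f 0"
    by (simp add: integral_unique)
  moreover have "integral {0..1} (\<lambda>z. f'' z * sin (w * z) + w^2 * (f z * sin (w * z)))
    = sin_coef f'' w + w^2 * sin_coef f w"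
    unfolding sin_coef_def integral_mult_right[symmetric]
    by (intro integral_add integrable_continuous_real continuous_intros C2_triple_continuous[OF assms])
  ultimately show ?thesis by (simp add: algebra_simps)
qed

lemma sin_coef_sin_self:
  assumes "w \<noteq> 0"
  shows "sin_coef (\<lambda>z. sin (w * z)) w = 1/2 - sin (2 * w) / (4 * w)"
proof -
  have "((\<lambda>z. z/2 - sin (2 * w * z) / (4 * w)) has_real_derivative sin (w * z) * sin (w * z)) (at z within {0..1})" for z
  proof -
    have "((\<lambda>z. z/2 - sin (2 * w * z) / (4 * w)) has_real_derivative 1/2 - cos (2 * w * z) / 2) (at z within {0..1})"
      using assms by (auto intro!: derivative_eq_intros simp: field_simps)
    also have "1/2 - cos (2 * w * z) / 2 = sin (w * z) * sin (w * z)"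
      using cos_double_sin[of "w * z"] by (simp add: mult.assoc power2_eq_square field_simps)
    finally show ?thesis .
  qed
  then have "((\<lambda>z. sin (w * z) * sin (w * z)) has_integral
      (1/2 - sin (2 * w * 1) / (4 * w)) - (0/2 - sin (2 * w * 0) / (4 * w))) {0..1}"
    by (intro fundamental_theorem_of_calculus) (auto simp flip: has_real_derivative_iff_has_vector_derivative)
  then show ?thesis by (simp add: sin_coef_def integral_unique)
qed

text \<open>Dirichlet and Robin conditions at 1 are treated together through the pair
  \<open>\<alpha>\<close>, \<open>\<beta>\<close>. The windows for \<open>\<omega> n\<close> reflect
  that \<open>mu\<close> lies in [0, 1/2]. Completeness enters as the assumption
  \<open>total\<close>, so its analytic proof stays outside.\<close>

locale robin_system =
  fixes \<alpha> \<beta> :: real and \<omega> :: "nat \<Rightarrow> real"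
  assumes nonneg: "\<alpha> \<ge> 0" "\<beta> \<ge> 0" "\<alpha> + \<beta> > 0"
    and lower: "(real n + 1/2) * pi \<le> \<omega> n" and upper: "\<omega> n \<le> (real n + 1) * pi"
    and eigen: "\<beta> * (\<omega> n * cos (\<omega> n)) + \<alpha> * sin (\<omega> n) = 0"
    and total: "\<lbrakk>continuous_on {0..1} f; \<And>n. sin_coef f (\<omega> n) = 0; z \<in> {0..1}\<rbrakk> \<Longrightarrow> f z = 0"
begin

definition bc :: "(real \<Rightarrow> real) \<Rightarrow> (real \<Rightarrow> real) \<Rightarrow> bool" where
  "bc f f' \<longleftrightarrow> \<beta> * f' 1 + \<alpha> * f 1 = 0"

definition N :: "nat \<Rightarrow> real" where "N n = sin_coef (\<lambda>z. sin (\<omega> n * z)) (\<omega> n)"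

lemma \<omega>_ge: "real n + 1 \<le> \<omega> n"
proof -
  have "(real n + 1/2) * 2 \<le> (real n + 1/2) * pi" using pi_gt3 by (intro mult_left_mono) auto
  with lower[of n] show ?thesis by simp
qed

lemma \<omega>_pos: "\<omega> n > 0" using \<omega>_ge[of n] by linarith

lemma \<omega>_less:
  assumes "m < n" shows "\<omega> m < \<omega> n"
proof -
  have "\<omega> m \<le> (real m + 1) * pi" by (rule upper)
  also have "\<dots> \<le> real n * pi" using assms by (intro mult_right_mono) auto
  also have "\<dots> < (real n + 1/2) * pi" by (intro mult_strict_right_mono) auto
  also have "\<dots> \<le> \<omega> n" by (rule lower)
  finally show ?thesis .
qed

text \<open>This Wronskian at 1 vanishes because \<open>f\<close> and the eigenfunction satisfy the
  same condition there: multiplied by \<open>\<beta>\<close> or by \<open>\<alpha>\<close> it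
  becomes a combination of the two conditions, and one of these numbers is nonzero.\<close>

lemma bc_det:
  assumes "bc f f'"
  shows "f' 1 * sin (\<omega> n) = \<omega> n * (f 1 * cos (\<omega> n))"
proof -
  have "\<beta> * (f' 1 * sin (\<omega> n) - \<omega> n * (f 1 * cos (\<omega> n))) = 
      (\<beta> * f' 1 + \<alpha> * f 1) * sin (\<omega> n) - f 1 * (\<beta> * (\<omega> n * cos (\<omega> n)) + \<alpha> * sin (\<omega> n))"
    by (simp add: algebra_simps)
  moreover have "\<alpha> * (f' 1 * sin (\<omega> n) - \<omega> n * (f 1 * cos (\<omega> n))) = 
      f' 1 * (\<beta> * (\<omega> n * cos (\<omega> n)) + \<alpha> * sin (\<omega> n)) - (\<beta> * f' 1 + \<alpha> * f 1) * (\<omega> n * cos (\<omega> n))"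
    by (simp add: algebra_simps)
  ultimately show ?thesis
    using assms eigen[of n] nonneg unfolding bc_def by auto
qed

text \<open>The terms at 1 cancel by \<open>bc_det\<close>. The surviving term with
  \<open>f 0\<close> is how the boundary datum enters the equation for the coefficients.\<close>

lemma sin_coef_bc:
  assumes "C2_triple f f' f''" "bc f f'"
  shows "sin_coef f'' (\<omega> n) = \<omega> n * f 0 - (\<omega> n)^2 * sin_coef f (\<omega> n)"
  using sin_coef_second_derivative[OF assms(1), of "\<omega> n"] bc_det[OF assms(2), of n]
  by (simp add: algebra_simps)

lemma bc_sin: "bc (\<lambda>z. sin (\<omega> m * z)) (\<lambda>z. \<omega> m * cos (\<omega> m * z))"
  using eigen[of m] by (simp add: bc_def)

text \<open>Symmetry argument: \<open>sin_coef_bc\<close> for the m-th eigenfunction, which vanishes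
  at 0, equates its coefficient multiplied by two different eigenvalues.\<close>

lemma orthogonal:
  assumes "m \<noteq> n"
  shows "sin_coef (\<lambda>z. sin (\<omega> m * z)) (\<omega> n) = 0"
proof -
  have "(\<omega> m)^2 * sin_coef (\<lambda>z. sin (\<omega> m * z)) (\<omega> n) = (\<omega> n)^2 * sin_coef (\<lambda>z. sin (\<omega> m * z)) (\<omega> n)"
    using sin_coef_bc[OF C2_triple_sin bc_sin, of m n, unfolded sin_coef_cmult] by simp
  moreover have "\<omega> m \<noteq> \<omega> n" using assms \<omega>_less by (metis linorder_neq_iff order_less_irrefl)
  then have "(\<omega> m)^2 \<noteq> (\<omega> n)^2"
    using \<omega>_pos[of m] \<omega>_pos[of n] by (simp add: power2_eq_iff_nonneg)
  ultimately show ?thesis by simp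
qed

lemma N_eq: "N n = 1/2 - sin (2 * \<omega> n) / (4 * \<omega> n)"
  unfolding N_def using \<omega>_pos[of n] by (intro sin_coef_sin_self) auto

text \<open>The eigenvalue equation forces \<open>sin (\<omega> n)\<close> and
  \<open>cos (\<omega> n)\<close> to have a product of sign at most 0, so the correction in
  \<open>N_eq\<close> only increases \<open>N n\<close>.\<close>

lemma N_ge: "N n \<ge> 1/2"
proof -
  have "sin (\<omega> n) * cos (\<omega> n) \<le> 0"
  proof (cases "\<beta> = 0")
    case True
    then show ?thesis using eigen[of n] nonneg by simp
  next
    case False
    have "\<beta> * \<omega> n * (sin (\<omega> n) * cos (\<omega> n)) = - \<alpha> * (sin (\<omega> n))^2"
      using eigen[of n] by (simp add: power2_eq_square) algebra
    also have "\<dots> \<le> 0" using nonneg by simp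
    finally show ?thesis using False nonneg \<omega>_pos[of n] by (simp add: mult_le_0_iff)
  qed
  then have "sin (2 * \<omega> n) \<le> 0" unfolding sin_double by linarith
  then have "sin (2 * \<omega> n) / (4 * \<omega> n) \<le> 0"
    using \<omega>_pos[of n] by (intro divide_nonpos_pos) auto
  then show ?thesis by (simp add: N_eq)
qed

lemma N_pos: "N n > 0" using N_ge[of n] by linarith

text \<open>The coefficients \<open>c\<close> are arbitrary: Bessel's inequality uses the optimal
  ones, while the proof of Parseval's inequality compares with those of another function.\<close>

lemma integral_diff_sum_square:
  assumes f: "continuous_on {0..1} f"
  shows "integral {0..1} (\<lambda>z. (f z - (\<Sum>i<n. c i * sin (\<omega> i * z)))^2)
    = integral {0..1} (\<lambda>z. (f z)^2) + (\<Sum>i<n. (c i)^2 * N i - 2 * c i * sin_coef f (\<omega> i))"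
proof (induction n)
  case (Suc n)
  define g where "g = (\<lambda>z. f z - (\<Sum>i<n. c i * sin (\<omega> i * z)))"
  have g: "continuous_on {0..1} g" unfolding g_def by (intro continuous_intros f)
  have "sin_coef (\<lambda>z. \<Sum>i<n. c i * sin (\<omega> i * z)) (\<omega> n)
      = (\<Sum>i<n. sin_coef (\<lambda>z. c i * sin (\<omega> i * z)) (\<omega> n))"
    unfolding sin_coef_def sum_distrib_right
    by (intro integral_sum integrable_continuous_real continuous_intros) auto
  also have "\<dots> = 0" by (simp add: sin_coef_cmult orthogonal)
  finally have gn: "sin_coef g (\<omega> n) = sin_coef f (\<omega> n)"
    unfolding g_def by (subst sin_coef_diff) (auto intro!: continuous_intros f)
  have "integral {0..1} (\<lambda>z. (f z - (\<Sum>i<Suc n. c i * sin (\<omega> i * z)))^2)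
    = integral {0..1} (\<lambda>z. (g z)^2 + ((c n)^2 * (sin (\<omega> n * z) * sin (\<omega> n * z)) - 2 * c n * (g z * sin (\<omega> n * z))))"
    by (intro integral_cong) (simp add: g_def power2_eq_square algebra_simps)
  also have "\<dots> = integral {0..1} (\<lambda>z. (g z)^2) + ((c n)^2 * N n - 2 * c n * sin_coef g (\<omega> n))"
    unfolding N_def sin_coef_def integral_mult_right[symmetric]
    by (subst integral_add integral_diff; (intro integrable_continuous_real continuous_intros g)?)+ simp
  finally show ?case using Suc unfolding gn unfolding g_def by simp
qed simp

lemma bessel:
  assumes f: "continuous_on {0..1} f"
  shows "(\<Sum>i<n. (sin_coef f (\<omega> i))^2 / N i) \<le> integral {0..1} (\<lambda>z. (f z)^2)"
proof -
  have "0 \<le> integral {0..1} (\<lambda>z. (f z - (\<Sum>i<n. sin_coef f (\<omega> i) / N i * sin (\<omega> i * z)))^2)"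
    by (intro integral_nonneg integrable_continuous_real continuous_intros f) auto
  also have "\<dots> = integral {0..1} (\<lambda>z. (f z)^2) - (\<Sum>i<n. (sin_coef f (\<omega> i))^2 / N i)"
  proof -
    have "x^2 / N i = - ((x / N i)^2 * N i - 2 * (x / N i) * x)" for x i
      using N_pos[of i] by (simp add: field_simps power2_eq_square)
    then show ?thesis unfolding integral_diff_sum_square[OF f] by (simp only: sum_negf)
  qed
  finally show ?thesis by simp
qed

lemma summable_bessel:
  assumes f: "continuous_on {0..1} f"
  shows "summable (\<lambda>i. (sin_coef f (\<omega> i))^2 / N i)"
    "(\<Sum>i. (sin_coef f (\<omega> i))^2 / N i) \<le> integral {0..1} (\<lambda>z. (f z)^2)"
proof -
  show s: "summable (\<lambda>i. (sin_coef f (\<omega> i))^2 / N i)"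
    by (rule summableI_nonneg_bounded[OF _ bessel[OF f]]) (use N_pos in \<open>simp add: less_imp_le\<close>)
  show "(\<Sum>i. (sin_coef f (\<omega> i))^2 / N i) \<le> integral {0..1} (\<lambda>z. (f z)^2)"
    by (rule suminf_le_const[OF s bessel[OF f]])
qed

text \<open>Completing the square term by term leaves the excess
  \<open>(c i * N i - sin_coef f (\<omega> i))^2 / N i\<close>.\<close>

lemma best_approximation:
  assumes f: "continuous_on {0..1} f"
  shows "integral {0..1} (\<lambda>z. (f z)^2) - (\<Sum>i<n. (sin_coef f (\<omega> i))^2 / N i)
    \<le> integral {0..1} (\<lambda>z. (f z - (\<Sum>i<n. c i * sin (\<omega> i * z)))^2)"
proof -
  have "- ((sin_coef f (\<omega> i))^2 / N i) \<le> (c i)^2 * N i - 2 * c i * sin_coef f (\<omega> i)" for i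
  proof -
    have "(c i)^2 * N i - 2 * c i * sin_coef f (\<omega> i) + (sin_coef f (\<omega> i))^2 / N i
        = (c i * N i - sin_coef f (\<omega> i))^2 / N i"
      using N_pos[of i] by (simp add: field_simps power2_eq_square)
    also have "\<dots> \<ge> 0" using N_pos[of i] by (intro divide_nonneg_pos) auto
    finally show ?thesis by linarith
  qed
  then show ?thesis
    unfolding integral_diff_sum_square[OF f] diff_conv_add_uminus[of "integral _ _" "sum _ _"] sum_negf[symmetric]
    by (intro add_left_mono sum_mono)
qed

section \<open>Absolutely convergent sine series and expansion of smooth functions\<close>

lemma uniform_limit_sine_series:
  assumes "summable b" "\<And>n. \<bar>c n\<bar> \<le> b n"
  shows "uniform_limit {0..1} (\<lambda>n z. \<Sum>i<n. c i * sin (\<omega> i * z)) (\<lambda>z. \<Sum>i. c i * sin (\<omega> i * z)) sequentially"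
proof (rule Weierstrass_m_test[OF _ assms(1)])
  fix n z
  have "\<bar>c n\<bar> * \<bar>sin (\<omega> n * z)\<bar> \<le> b n * 1" using assms(2)[of n] by (intro mult_mono) auto
  then show "norm (c n * sin (\<omega> n * z)) \<le> b n" by (simp add: abs_mult)
qed

lemma sin_coef_sine_series:
  assumes "summable b" "\<And>n. \<bar>c n\<bar> \<le> b n"
  shows "continuous_on {0..1} (\<lambda>z. \<Sum>i. c i * sin (\<omega> i * z))"
    "sin_coef (\<lambda>z. \<Sum>i. c i * sin (\<omega> i * z)) (\<omega> m) = c m * N m"
proof -
  note ul = uniform_limit_sine_series[OF assms]
  show co: "continuous_on {0..1} (\<lambda>z. \<Sum>i. c i * sin (\<omega> i * z))"
    by (rule uniform_limit_theorem[OF _ ul]) (auto intro!: always_eventually continuous_intros)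
  have "uniform_limit {0..1} (\<lambda>n z. (\<Sum>i<n. c i * sin (\<omega> i * z)) * sin (\<omega> m * z))
      (\<lambda>z. (\<Sum>i. c i * sin (\<omega> i * z)) * sin (\<omega> m * z)) sequentially"
    by (intro uniform_lim_mult ul uniform_limit_const compact_imp_bounded compact_continuous_image co continuous_intros) auto
  moreover have "continuous_on {0..1} (\<lambda>z. (\<Sum>i<n. c i * sin (\<omega> i * z)) * sin (\<omega> m * z))" for n
    by (intro continuous_intros)
  ultimately obtain I J where
    I: "\<And>n. ((\<lambda>z. (\<Sum>i<n. c i * sin (\<omega> i * z)) * sin (\<omega> m * z)) has_integral I n) {0..1}"
    and J: "((\<lambda>z. (\<Sum>i. c i * sin (\<omega> i * z)) * sin (\<omega> m * z)) has_integral J) {0..1}" "I \<longlonglongrightarrow> J"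
    using uniform_limit_integral[OF _ _ sequentially_bot] by blast
  have "I n = (\<Sum>i<n. c i * sin_coef (\<lambda>z. sin (\<omega> i * z)) (\<omega> m))" for n
  proof -
    have "I n = integral {0..1} (\<lambda>z. \<Sum>i<n. c i * (sin (\<omega> i * z) * sin (\<omega> m * z)))"
      using I[of n] by (simp add: integral_unique sum_distrib_right mult.assoc)
    also have "\<dots> = (\<Sum>i<n. integral {0..1} (\<lambda>z. c i * (sin (\<omega> i * z) * sin (\<omega> m * z))))"
      by (intro integral_sum integrable_continuous_real continuous_intros) auto
    finally show ?thesis by (simp add: sin_coef_def)
  qed
  \<comment> \<open>The partial sum over \<open>i < n\<close> contains the index \<open>m\<close>
    only for \<open>n > m\<close>; from then on its coefficient is constant.\<close>
  also have "(\<Sum>i<n. c i * sin_coef (\<lambda>z. sin (\<omega> i * z)) (\<omega> m)) = c m * N m" if "n > m" for n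
  proof -
    have "(\<Sum>i<n. c i * sin_coef (\<lambda>z. sin (\<omega> i * z)) (\<omega> m)) = (\<Sum>i<n. if i = m then c m * N m else 0)"
      by (intro sum.cong) (auto simp: orthogonal N_def)
    then show ?thesis using that by simp
  qed
  finally have "\<forall>\<^sub>F n in sequentially. I n = c m * N m"
    by (metis (mono_tags, lifting) eventually_gt_at_top eventually_mono)
  then have "I \<longlonglongrightarrow> c m * N m" by (simp add: tendsto_eventually)
  then have "J = c m * N m" using J(2) LIMSEQ_unique by blast
  then show "sin_coef (\<lambda>z. \<Sum>i. c i * sin (\<omega> i * z)) (\<omega> m) = c m * N m"
    using J(1) by (simp add: sin_coef_def integral_unique)
qed

lemma summable_inverse_\<omega>_square: "summable (\<lambda>n. C / (\<omega> n)^2)"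
proof (rule summable_comparison_test')
  show "summable (\<lambda>n. \<bar>C\<bar> * (1 / (real (Suc n))^2))"
    using inverse_squares_sums by (intro summable_mult) (auto simp: sums_iff add.commute)
  fix n
  have "\<bar>C\<bar> / (\<omega> n)^2 \<le> \<bar>C\<bar> / (real (Suc n))^2"
    using \<omega>_ge[of n] by (intro divide_left_mono power_mono mult_pos_pos) (auto simp: \<omega>_pos)
  then show "norm (C / (\<omega> n)^2) \<le> \<bar>C\<bar> * (1 / (real (Suc n))^2)" by (simp add: abs_divide)
qed

text \<open>With \<open>f 0 = 0\<close> no boundary term is left, so the coefficient of
  \<open>f\<close> is that of \<open>f''\<close> divided by \<open>- (\<omega> n)^2\<close>. The
  bound \<open>N n >= 1/2\<close> contributes the factor 2.\<close>

lemma nice_coef_bound: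
  assumes f: "C2_triple f f' f''" "bc f f'" "f 0 = 0"
  obtains C where "C > 0" "\<And>n. \<bar>sin_coef f (\<omega> n) / N n\<bar> \<le> C / (\<omega> n)^2"
proof -
  obtain B where B: "B > 0" "\<And>z. z \<in> {0..1} \<Longrightarrow> \<bar>f'' z\<bar> \<le> B"
    using continuous_on_Icc_bound[OF C2_triple_continuous(3)[OF f(1)]] by metis
  have "\<bar>sin_coef f (\<omega> n) / N n\<bar> \<le> 2 * B / (\<omega> n)^2" for n
  proof -
    have "\<bar>sin_coef f (\<omega> n)\<bar> * (\<omega> n)^2 = \<bar>sin_coef f'' (\<omega> n)\<bar>"
      using sin_coef_bc[OF f(1,2), of n] f(3) by (simp add: abs_mult)
    also have "\<dots> \<le> B" by (rule abs_sin_coef_le[OF C2_triple_continuous(3)[OF f(1)] B(2)])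
    finally have "\<bar>sin_coef f (\<omega> n)\<bar> \<le> B / (\<omega> n)^2" using \<omega>_pos[of n] by (simp add: pos_le_divide_eq)
    moreover have "\<bar>sin_coef f (\<omega> n) / N n\<bar> \<le> \<bar>sin_coef f (\<omega> n)\<bar> / (1/2)"
      using N_ge[of n] N_pos[of n] unfolding abs_divide by (intro divide_left_mono) auto
    ultimately show ?thesis by simp
  qed
  with B(1) that[of "2 * B"] show ?thesis by simp
qed

text \<open>The series converges uniformly to a continuous function with the same coefficients as
  \<open>f\<close>; \<open>total\<close> applied to the difference identifies the two.\<close>

lemma nice_expansion:
  assumes f: "C2_triple f f' f''" "bc f f'" "f 0 = 0"
  shows "uniform_limit {0..1} (\<lambda>n z. \<Sum>i<n. sin_coef f (\<omega> i) / N i * sin (\<omega> i * z)) f sequentially"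
    "z \<in> {0..1} \<Longrightarrow> (\<Sum>i. sin_coef f (\<omega> i) / N i * sin (\<omega> i * z)) = f z"
proof -
  obtain C where "\<And>n. \<bar>sin_coef f (\<omega> n) / N n\<bar> \<le> C / (\<omega> n)^2"
    using nice_coef_bound[OF f] by metis
  note c = summable_inverse_\<omega>_square[of C] this
  define g where "g = (\<lambda>z. \<Sum>i. sin_coef f (\<omega> i) / N i * sin (\<omega> i * z))"
  have g: "continuous_on {0..1} g" unfolding g_def by (rule sin_coef_sine_series(1)[OF c])
  note cf = C2_triple_continuous(1)[OF f(1)]
  have "sin_coef (\<lambda>z. g z - f z) (\<omega> m) = 0" for m
    using sin_coef_sine_series(2)[OF c, of m, folded g_def] N_pos[of m]
    by (simp add: sin_coef_diff[OF g cf])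
  from total[OF _ this] have eq: "g z = f z" if "z \<in> {0..1}" for z
    using that by (force intro: continuous_intros g cf)
  then show "z \<in> {0..1} \<Longrightarrow> (\<Sum>i. sin_coef f (\<omega> i) / N i * sin (\<omega> i * z)) = f z"
    by (simp add: g_def)
  from eq show "uniform_limit {0..1} (\<lambda>n z. \<Sum>i<n. sin_coef f (\<omega> i) / N i * sin (\<omega> i * z)) f sequentially"
    using uniform_limit_sine_series[OF c] by (subst uniform_limit_cong'[of _ _ _ f g]) (auto simp: g_def)
qed

text \<open>
  Since \<open>f 0\<close> need not vanish, the series of \<open>f\<close> need not converge uniformly; the \<open>L\<^sup>2\<close>-small corrector
  \<open>f 0 * (1 - z)^(m+2)\<close> reduces the claim to \<open>nice_expansion\<close> without disturbing the condition at \<open>1\<close>.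
\<close>

lemma parseval_le:
  assumes f: "C2_triple f f' f''" "bc f f'"
  shows "integral {0..1} (\<lambda>z. (f z)^2) \<le> (\<Sum>i. (sin_coef f (\<omega> i))^2 / N i)"
proof (rule field_le_epsilon)
  fix \<epsilon> :: real assume \<epsilon>: "\<epsilon> > 0"
  note cf = C2_triple_continuous(1)[OF f(1)]
  \<comment> \<open>The corrector \<open>h\<close> has squared norm
    \<open>(f 0)^2 / (2 * m + 5)\<close>; this \<open>m\<close> brings twice that below \<epsilon> /
    2.\<close>
  obtain m :: nat where m: "real m > 4 * (f 0)^2 / \<epsilon>" using reals_Archimedean2 by blast
  have pow: "((\<lambda>z. (1 - z)^Suc k) has_real_derivative - (real (Suc k) * (1 - z)^k)) (at z within S)" for k z S
    by (rule DERIV_cong, (rule derivative_intros)+) (simp add: algebra_simps)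
  \<comment> \<open>The exponent is at least 2, so both \<open>h\<close> and \<open>h'\<close>
    vanish at 1.\<close>
  define h where "h = (\<lambda>z::real. f 0 * (1 - z)^Suc (Suc m))"
  define h' where "h' = (\<lambda>z::real. f 0 * - (real (Suc (Suc m)) * (1 - z)^Suc m))"
  define h'' where "h'' = (\<lambda>z::real. f 0 * - (real (Suc (Suc m)) * - (real (Suc m) * (1 - z)^m)))"
  have h: "C2_triple h h' h''"
    unfolding C2_triple_def h_def h'_def h''_def
    by (intro conjI ballI DERIV_cmult DERIV_minus pow) (intro continuous_intros)
  have ch: "continuous_on {0..1} h" using C2_triple_continuous(1)[OF h] .
  have "((\<lambda>z. - ((f 0)^2 / real (Suc (2*m+4))) * (1 - z)^Suc (2*m+4)) has_real_derivative (h z)^2) (at z within {0..1})" for z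
  proof -
    have "- (A / real (Suc k)) * - (real (Suc k) * P) = A * P" for A P :: real and k
      by (simp del: of_nat_Suc)
    then have "- ((f 0)^2 / real (Suc (2*m+4))) * - (real (Suc (2*m+4)) * (1 - z)^(2*m+4)) = (f 0)^2 * (1 - z)^(2*m+4)"
      by blast
    also have "\<dots> = (h z)^2"
    proof -
      have "Suc (Suc m) * 2 = 2*m+4" by simp
      then show ?thesis unfolding h_def power_mult_distrib power_mult[symmetric] by (simp only:)
    qed
    finally show ?thesis using DERIV_cmult[OF pow] by metis
  qed
  then have "((\<lambda>z. (h z)^2) has_integral - ((f 0)^2 / real (Suc (2*m+4))) * (1 - 1)^Suc (2*m+4) - - ((f 0)^2 / real (Suc (2*m+4))) * (1 - 0)^Suc (2*m+4)) {0..1}"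
    by (intro fundamental_theorem_of_calculus) (auto simp flip: has_real_derivative_iff_has_vector_derivative)
  then have inth: "integral {0..1} (\<lambda>z. (h z)^2) = (f 0)^2 / real (Suc (2*m+4))"
    by (simp add: integral_unique)
  have "2 * (f 0)^2 / real (Suc (2*m+4)) \<le> \<epsilon> / 2"
  proof -
    have "4 * (f 0)^2 \<le> \<epsilon> * real m" using m \<epsilon> by (simp add: field_simps)
    also have "\<dots> \<le> \<epsilon> * real (Suc (2*m+4))" using \<epsilon> by (intro mult_left_mono) auto
    finally show ?thesis by (simp add: field_simps)
  qed
  then have h_small: "2 * integral {0..1} (\<lambda>z. (h z)^2) \<le> \<epsilon> / 2" by (simp add: inth)
  define g where "g = (\<lambda>z. f z - h z)"
  have g: "C2_triple g (\<lambda>z. f' z - h' z) (\<lambda>z. f'' z - h'' z)"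
    unfolding g_def by (rule C2_triple_diff[OF f(1) h])
  have g0: "g 0 = 0" "bc g (\<lambda>z. f' z - h' z)"
    using f(2) by (auto simp: g_def h_def h'_def bc_def)
  \<comment> \<open>These are the coefficients of \<open>g\<close>, not of \<open>f\<close>. Used in
    \<open>best_approximation\<close> for \<open>f\<close>, they leave the error \<open>h\<close>
    plus a uniformly small remainder \<open>r\<close>, and the tolerance
    \<open>sqrt (\<epsilon> / 4)\<close> makes \<open>2 * r^2\<close> at most \<epsilon> /
    2.\<close>
  define c where "c i = sin_coef g (\<omega> i) / N i" for i
  from nice_expansion(1)[OF g g0(2,1)]
  have "uniform_limit {0..1} (\<lambda>n z. \<Sum>i<n. c i * sin (\<omega> i * z)) g sequentially" by (simp add: c_def)
  then have "\<forall>\<^sub>F n in sequentially. \<forall>z\<in>{0..1}. dist (\<Sum>i<n. c i * sin (\<omega> i * z)) (g z) < sqrt (\<epsilon> / 4)"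
    using \<epsilon> by (intro uniform_limitD) auto
  then obtain n where n: "\<And>z. z \<in> {0..1} \<Longrightarrow> \<bar>(\<Sum>i<n. c i * sin (\<omega> i * z)) - g z\<bar> < sqrt (\<epsilon> / 4)"
    unfolding eventually_sequentially dist_real_def by blast
  have "integral {0..1} (\<lambda>z. (f z)^2) - (\<Sum>i<n. (sin_coef f (\<omega> i))^2 / N i)
      \<le> integral {0..1} (\<lambda>z. (f z - (\<Sum>i<n. c i * sin (\<omega> i * z)))^2)"
    by (rule best_approximation[OF cf])
  also have "\<dots> \<le> integral {0..1} (\<lambda>z. 2 * (h z)^2 + \<epsilon> / 2)"
  proof (rule integral_le)
    fix z :: real assume z: "z \<in> {0..1}"
    define r where "r = g z - (\<Sum>i<n. c i * sin (\<omega> i * z))"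
    have "r^2 \<le> (sqrt (\<epsilon> / 4))^2"
      using n[OF z] by (intro abs_le_square_iff[THEN iffD1]) (auto simp: r_def abs_minus_commute)
    then have "r^2 \<le> \<epsilon> / 4" using \<epsilon> by simp
    moreover have "f z - (\<Sum>i<n. c i * sin (\<omega> i * z)) = h z + r" by (simp add: r_def g_def)
    moreover have "(h z + r)^2 \<le> 2 * (h z)^2 + 2 * r^2"
      using zero_le_power2[of "h z - r"] by (simp add: power2_eq_square algebra_simps)
    ultimately show "(f z - (\<Sum>i<n. c i * sin (\<omega> i * z)))^2 \<le> 2 * (h z)^2 + \<epsilon> / 2" by simp
  qed (intro integrable_continuous_real continuous_intros cf ch)+
  also have "\<dots> = 2 * integral {0..1} (\<lambda>z. (h z)^2) + \<epsilon> / 2"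
    by (subst integral_add) (auto intro!: integrable_continuous_real continuous_intros ch)
  also have "\<dots> \<le> \<epsilon>" using h_small by simp
  finally have "integral {0..1} (\<lambda>z. (f z)^2) \<le> (\<Sum>i<n. (sin_coef f (\<omega> i))^2 / N i) + \<epsilon>" by simp
  also have "(\<Sum>i<n. (sin_coef f (\<omega> i))^2 / N i) \<le> (\<Sum>i. (sin_coef f (\<omega> i))^2 / N i)"
    using N_pos by (intro sum_le_suminf summable_bessel cf) (auto simp: less_imp_le)
  finally show "integral {0..1} (\<lambda>z. (f z)^2) \<le> (\<Sum>i. (sin_coef f (\<omega> i))^2 / N i) + \<epsilon>" by simp
qed

end

section \<open>Coefficient dynamics, uniqueness and the estimate\<close>

text \<open>The function \<open>exp (l * t) * (c t - K)\<close> is nonincreasing, its derivative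
  being \<open>exp (l * t) * (g t - l * K)\<close>.\<close>

lemma linear_ode_upper_bound:
  fixes c :: "real \<Rightarrow> real"
  assumes cont: "continuous_on {0..T} c" and T: "T \<ge> 0"
    and ode: "\<And>t. 0 < t \<Longrightarrow> t < T \<Longrightarrow> (c has_real_derivative - l * c t + g t) (at t)"
    and g: "\<And>t. 0 < t \<Longrightarrow> t < T \<Longrightarrow> g t \<le> l * K" and K: "K \<ge> 0"
  shows "c T \<le> exp (- l * T) * \<bar>c 0\<bar> + K"
proof -
  have "exp (l * T) * (c T - K) \<le> exp (l * 0) * (c 0 - K)"
  proof (rule DERIV_nonpos_imp_decreasing_open[OF T])
    fix t assume t: "0 < t" "t < T"
    have "((\<lambda>t. exp (l * t) * (c t - K)) has_real_derivative exp (l * t) * (g t - l * K)) (at t)"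
      using ode[OF t] by (auto intro!: derivative_eq_intros simp: algebra_simps)
    moreover have "exp (l * t) * (g t - l * K) \<le> 0"
      using g[OF t] by (intro mult_nonneg_nonpos) auto
    ultimately show "\<exists>y. ((\<lambda>t. exp (l * t) * (c t - K)) has_real_derivative y) (at t) \<and> y \<le> 0" by blast
  qed (intro continuous_intros cont)
  also have "\<dots> \<le> \<bar>c 0\<bar>" using K by simp
  finally have "exp (- l * T) * (exp (l * T) * (c T - K)) \<le> exp (- l * T) * \<bar>c 0\<bar>"
    by (intro mult_left_mono) auto
  then show ?thesis by (simp add: mult.assoc[symmetric] exp_add[symmetric])
qed

lemma linear_ode_bound:
  fixes c :: "real \<Rightarrow> real"
  assumes cont: "continuous_on {0..T} c" and T: "T \<ge> 0"
    and ode: "\<And>t. 0 < t \<Longrightarrow> t < T \<Longrightarrow> (c has_real_derivative - l * c t + g t) (at t)"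
    and g: "\<And>t. 0 < t \<Longrightarrow> t < T \<Longrightarrow> \<bar>g t\<bar> \<le> l * K" and K: "K \<ge> 0"
  shows "\<bar>c T\<bar> \<le> exp (- l * T) * \<bar>c 0\<bar> + K"
proof -
  have "c T \<le> exp (- l * T) * \<bar>c 0\<bar> + K"
    using g abs_le_D1 by (intro linear_ode_upper_bound[OF cont T ode _ K]) auto
  moreover have "- c T \<le> exp (- l * T) * \<bar>- c 0\<bar> + K"
  proof (rule linear_ode_upper_bound[OF _ T _ _ K])
    show "((\<lambda>t. - c t) has_real_derivative - l * - c t + - g t) (at t)" if "0 < t" "t < T" for t
      using ode[OF that] by (auto intro!: derivative_eq_intros)
    show "- g t \<le> l * K" if "0 < t" "t < T" for t using g[OF that] by linarith
  qed (intro continuous_intros cont)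
  ultimately show ?thesis by simp
qed

text \<open>Young's inequality, with slack \<open>(\<epsilon> * x - y)^2 / \<epsilon>\<close>; it is
  the source of the factors \<open>1 + \<epsilon>\<close> and \<open>1 + 1 / \<epsilon>\<close> in
  the estimate.\<close>

lemma square_sum_le_weighted:
  fixes x y \<epsilon> :: real
  assumes "\<epsilon> > 0"
  shows "(x + y)^2 \<le> (1 + \<epsilon>) * x^2 + (1 + 1 / \<epsilon>) * y^2"
proof -
  have "(1 + \<epsilon>) * x^2 + (1 + 1 / \<epsilon>) * y^2 - (x + y)^2 = (\<epsilon> * x - y)^2 / \<epsilon>"
    using assms by (simp add: field_simps power2_eq_square)
  also have "\<dots> \<ge> 0" using assms by simp
  finally show ?thesis by simp
qed

section \<open>Solutions of the transformed equation and their sine coefficients\<close>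

context robin_system
begin

text \<open>The function \<open>wt\<close> is common to all times because it is jointly continuous,
  whereas the spatial derivatives are chosen for each \<open>t\<close> separately: their existence
  is all that is asked, also at \<open>t = 0\<close>.\<close>

definition heat_solution :: "real \<Rightarrow> real \<Rightarrow> (real \<Rightarrow> real) \<Rightarrow> (real \<Rightarrow> real \<Rightarrow> real) \<Rightarrow> bool" where
  "heat_solution D \<zeta> d w \<longleftrightarrow>
     continuous_on ({0..} \<times> {0..1}) (\<lambda>(t, z). w t z) \<and>
     (\<exists>wt. (\<forall>t>0. \<forall>z\<in>{0..1}. ((\<lambda>s. w s z) has_real_derivative wt t z) (at t)) \<and>
        continuous_on ({0<..} \<times> {0..1}) (\<lambda>(t, z). wt t z) \<and>
        (\<forall>t\<ge>0. \<exists>w' w''. C2_triple (w t) w' w'' \<and> bc (w t) w' \<and>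
            (0 < t \<longrightarrow> (\<forall>z\<in>{0<..<1}. wt t z = D * (w'' z - \<zeta>^2 * w t z))))) \<and>
     (\<forall>t\<ge>0. w t 0 = d t)"

lemma heat_solution_C2:
  assumes "heat_solution D \<zeta> d w" "t \<ge> 0"
  obtains w' w'' where "C2_triple (w t) w' w''" "bc (w t) w'"
  using assms unfolding heat_solution_def by blast

lemma heat_solution_continuous:
  assumes "heat_solution D \<zeta> d w" "t \<ge> 0"
  shows "continuous_on {0..1} (w t)"
  using heat_solution_C2[OF assms] C2_triple_continuous(1) by metis

lemma sin_coef_continuous:
  assumes "heat_solution D \<zeta> d w"
  shows "continuous_on {0..} (\<lambda>t. sin_coef (w t) x)"
proof -
  have "continuous_on ({0..} \<times> {0..1}) (\<lambda>(t, z). w t z)" using assms by (simp add: heat_solution_def)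
  then have "continuous_on ({0..} \<times> cbox 0 1) (\<lambda>(t, z). w t z * sin (x * z))"
    by (auto simp: split_beta intro!: continuous_intros)
  from integral_continuous_on_param[OF this] show ?thesis by (simp add: sin_coef_def)
qed

text \<open>Differentiate under the integral, insert the equation, and let
  \<open>sin_coef_bc\<close> turn the second derivative into a multiplication plus the boundary
  datum.\<close>

lemma sin_coef_ode:
  assumes w: "heat_solution D \<zeta> d w" and t: "t > 0"
  shows "((\<lambda>t. sin_coef (w t) (\<omega> n)) has_real_derivative
     - (D * (\<zeta>^2 + (\<omega> n)^2)) * sin_coef (w t) (\<omega> n) + D * \<omega> n * d t) (at t)"
proof -
  from w obtain wt where
    wt: "\<And>t z. t > 0 \<Longrightarrow> z \<in> {0..1} \<Longrightarrow> ((\<lambda>s. w s z) has_real_derivative wt t z) (at t)"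
    and cwt: "continuous_on ({0<..} \<times> {0..1}) (\<lambda>(t, z). wt t z)"
    and pde: "\<And>t. t \<ge> 0 \<Longrightarrow> \<exists>w' w''. C2_triple (w t) w' w'' \<and> bc (w t) w' \<and>
            (0 < t \<longrightarrow> (\<forall>z\<in>{0<..<1}. wt t z = D * (w'' z - \<zeta>^2 * w t z)))"
    unfolding heat_solution_def by blast
  obtain w' w'' where w'': "C2_triple (w t) w' w''" "bc (w t) w'"
      "\<And>z. z \<in> {0<..<1} \<Longrightarrow> wt t z = D * (w'' z - \<zeta>^2 * w t z)"
    using pde[of t] t by auto
  have "((\<lambda>t. integral (cbox 0 1) (\<lambda>z. w t z * sin (\<omega> n * z))) has_real_derivative
      integral (cbox 0 1) (\<lambda>z. wt t z * sin (\<omega> n * z))) (at t within {0<..})"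
  proof (rule leibniz_rule_field_derivative)
    show "((\<lambda>t. w t z * sin (\<omega> n * z)) has_real_derivative wt t z * sin (\<omega> n * z)) (at t within {0<..})"
      if "t \<in> {0<..}" "z \<in> cbox 0 1" for t z
      using wt[of t z] that by (intro DERIV_cmult_right) (auto intro: DERIV_subset)
    show "(\<lambda>z. w t z * sin (\<omega> n * z)) integrable_on cbox 0 1" if "t \<in> {0<..}" for t
      using heat_solution_continuous[OF w, of t] that
      by (intro integrable_continuous continuous_intros) auto
    show "continuous_on ({0<..} \<times> cbox 0 1) (\<lambda>(t, z). wt t z * sin (\<omega> n * z))"
      using cwt by (auto simp: split_beta intro!: continuous_intros)
  qed (use t in auto)
  then have "((\<lambda>t. sin_coef (w t) (\<omega> n)) has_real_derivative sin_coef (wt t) (\<omega> n)) (at t)"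
    using t by (simp add: sin_coef_def at_within_open[of t "{0<..}"])
  also have "sin_coef (wt t) (\<omega> n) = D * (sin_coef w'' (\<omega> n) - \<zeta>^2 * sin_coef (w t) (\<omega> n))"
  proof -
    note c = C2_triple_continuous[OF w''(1)]
    \<comment> \<open>The equation is known only at interior points; the two end points do not
      affect the integral.\<close>
    have "sin_coef (wt t) (\<omega> n) = sin_coef (\<lambda>z. D * (w'' z - \<zeta>^2 * w t z)) (\<omega> n)"
      by (rule sin_coef_cong) (rule w''(3))
    also have "\<dots> = D * (sin_coef w'' (\<omega> n) - \<zeta>^2 * sin_coef (w t) (\<omega> n))"
      by (simp add: sin_coef_cmult sin_coef_diff continuous_intros c)
    finally show ?thesis .
  qed
  also have "\<dots> = - (D * (\<zeta>^2 + (\<omega> n)^2)) * sin_coef (w t) (\<omega> n) + D * \<omega> n * d t"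
  proof -
    have "w t 0 = d t" using w t by (simp add: heat_solution_def)
    then show ?thesis unfolding sin_coef_bc[OF w''(1,2)] by (simp add: algebra_simps)
  qed
  finally show ?thesis .
qed

text \<open>The datum \<open>d\<close> cancels in the difference of coefficients, so
  \<open>linear_ode_bound\<close> with \<open>K = 0\<close> keeps that difference at 0, and
  \<open>total\<close> applies.\<close>

lemma heat_solution_unique:
  assumes w: "heat_solution D \<zeta> d w1" "heat_solution D \<zeta> d w2"
    and init: "\<And>z. z \<in> {0..1} \<Longrightarrow> w1 0 z = w2 0 z" and T: "T \<ge> 0" and z: "z \<in> {0..1}"
  shows "w1 T z = w2 T z"
proof -
  note c = heat_solution_continuous[OF w(1)] heat_solution_continuous[OF w(2)]
  have "sin_coef (\<lambda>z. w1 T z - w2 T z) (\<omega> n) = 0" for n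
  proof -
    define e where "e t = sin_coef (w1 t) (\<omega> n) - sin_coef (w2 t) (\<omega> n)" for t
    have "\<bar>e T\<bar> \<le> exp (- (D * (\<zeta>^2 + (\<omega> n)^2)) * T) * \<bar>e 0\<bar> + 0"
    proof (rule linear_ode_bound[where g = "\<lambda>_. 0"])
      show "continuous_on {0..T} e"
        unfolding e_def
        by (intro continuous_on_diff continuous_on_subset[OF sin_coef_continuous[OF w(1)]]
            continuous_on_subset[OF sin_coef_continuous[OF w(2)]]) auto
      show "(e has_real_derivative - (D * (\<zeta>^2 + (\<omega> n)^2)) * e t + 0) (at t)" if "0 < t" "t < T" for t
        using DERIV_diff[OF sin_coef_ode[OF w(1) that(1), of n] sin_coef_ode[OF w(2) that(1), of n]]
        unfolding e_def by (simp add: algebra_simps)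
    qed (use T in simp_all)
    moreover have "sin_coef (w1 0) (\<omega> n) = sin_coef (w2 0) (\<omega> n)"
      by (rule sin_coef_cong) (auto intro: init)
    ultimately show ?thesis using T by (simp add: e_def sin_coef_diff c)
  qed
  moreover have "continuous_on {0..1} (\<lambda>z. w1 T z - w2 T z)" using T by (intro continuous_intros c)
  ultimately show ?thesis using total[of "\<lambda>z. w1 T z - w2 T z" z] z by simp
qed

text \<open>The number \<open>\<omega> n / (\<zeta>^2 + (\<omega> n)^2)\<close> is the stationary
  response of the n-th coefficient to a constant unit datum.\<close>

lemma summable_gain: "summable (\<lambda>n. (\<omega> n / (\<zeta>^2 + (\<omega> n)^2))^2 / N n)"
proof (rule summable_comparison_test'[OF summable_inverse_\<omega>_square[of 2]])
  fix n
  have "\<omega> n / (\<zeta>^2 + (\<omega> n)^2) \<le> \<omega> n / (\<omega> n)^2"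
    using \<omega>_pos[of n] by (intro divide_left_mono mult_pos_pos add_nonneg_pos) auto
  then have "(\<omega> n / (\<zeta>^2 + (\<omega> n)^2))^2 \<le> (\<omega> n / (\<omega> n)^2)^2"
    using \<omega>_pos[of n] by (intro power_mono) (auto intro: divide_nonneg_nonneg)
  also have "\<dots> = 1 / (\<omega> n)^2" using \<omega>_pos[of n] by (simp add: power2_eq_square)
  finally have "(\<omega> n / (\<zeta>^2 + (\<omega> n)^2))^2 / N n \<le> (1 / (\<omega> n)^2) / (1/2)"
    using N_ge[of n] by (intro frac_le) auto
  then show "norm ((\<omega> n / (\<zeta>^2 + (\<omega> n)^2))^2 / N n) \<le> 2 / (\<omega> n)^2"
    using N_pos[of n] by simp
qed

text \<open>Each squared coefficient is split by Young's inequality into a decayed and a forced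
  part. Parseval's inequality passes from the norm to the coefficients at time \<open>T\<close>,
  Bessel's from the coefficients back to the norm at time 0.\<close>

lemma heat_solution_estimate:
  assumes w: "heat_solution D \<zeta> d w" and D: "D > 0" and T: "T \<ge> 0" and \<epsilon>: "\<epsilon> > 0"
    and M: "\<And>s. s \<in> {0..T} \<Longrightarrow> \<bar>d s\<bar> \<le> M"
  shows "sqrt (integral {0..1} (\<lambda>z. (w T z)^2))
    \<le> exp (- D * (\<zeta>^2 + (\<omega> 0)^2) * T) * sqrt ((1 + \<epsilon>) * integral {0..1} (\<lambda>z. (w 0 z)^2))
      + sqrt (1 + 1 / \<epsilon>) * sqrt (\<Sum>n. (\<omega> n / (\<zeta>^2 + (\<omega> n)^2))^2 / N n) * M"
proof -
  have M0: "M \<ge> 0" using M[of 0] T by simp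
  define E where "E = exp (- D * (\<zeta>^2 + (\<omega> 0)^2) * T)"
  define \<gamma> where "\<gamma> n = \<omega> n / (\<zeta>^2 + (\<omega> n)^2)" for n
  define A where "A n = (sin_coef (w 0) (\<omega> n))^2 / N n" for n
  define I where "I = integral {0..1} (\<lambda>z. (w 0 z)^2)"
  have den: "\<zeta>^2 + (\<omega> n)^2 > 0" for n using \<omega>_pos[of n] by (intro add_nonneg_pos) auto
  \<comment> \<open>The lowest frequency decays slowest, so its factor serves for every
    \<open>n\<close>.\<close>
  have E_mono: "exp (- (D * (\<zeta>^2 + (\<omega> n)^2)) * T) \<le> E" for n
  proof -
    have "\<omega> 0 \<le> \<omega> n" using \<omega>_less[of 0 n] by (cases "n = 0") auto
    then have "(\<omega> 0)^2 \<le> (\<omega> n)^2" using \<omega>_pos[of 0] by (intro power_mono) auto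
    then have "D * (\<zeta>^2 + (\<omega> 0)^2) * T \<le> D * (\<zeta>^2 + (\<omega> n)^2) * T"
      using D T by (intro mult_left_mono mult_right_mono) auto
    then show ?thesis by (simp add: E_def)
  qed
  have coef: "\<bar>sin_coef (w T) (\<omega> n)\<bar> \<le> E * \<bar>sin_coef (w 0) (\<omega> n)\<bar> + \<gamma> n * M" for n
  proof -
    have "\<bar>sin_coef (w T) (\<omega> n)\<bar>
       \<le> exp (- (D * (\<zeta>^2 + (\<omega> n)^2)) * T) * \<bar>sin_coef (w 0) (\<omega> n)\<bar> + \<gamma> n * M"
    proof (rule linear_ode_bound[where g = "\<lambda>t. D * \<omega> n * d t"])
      show "continuous_on {0..T} (\<lambda>t. sin_coef (w t) (\<omega> n))"
        using sin_coef_continuous[OF w] by (rule continuous_on_subset) auto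
      show "\<bar>D * \<omega> n * d t\<bar> \<le> D * (\<zeta>^2 + (\<omega> n)^2) * (\<gamma> n * M)" if "0 < t" "t < T" for t
      proof -
        have "D * \<omega> n * \<bar>d t\<bar> \<le> D * \<omega> n * M"
          using D \<omega>_pos[of n] M[of t] that by (intro mult_left_mono) auto
        also have "\<dots> = D * (\<zeta>^2 + (\<omega> n)^2) * (\<gamma> n * M)"
          using den[of n] by (simp add: \<gamma>_def)
        finally show ?thesis using D \<omega>_pos[of n] by (simp add: abs_mult)
      qed
      show "0 \<le> \<gamma> n * M" using den[of n] \<omega>_pos[of n] M0 by (simp add: \<gamma>_def)
      show "((\<lambda>t. sin_coef (w t) (\<omega> n)) has_real_derivative
          - (D * (\<zeta>^2 + (\<omega> n)^2)) * sin_coef (w t) (\<omega> n) + D * \<omega> n * d t) (at t)" if "0 < t" for t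
        by (rule sin_coef_ode[OF w that])
    qed (rule T)
    also have "exp (- (D * (\<zeta>^2 + (\<omega> n)^2)) * T) * \<bar>sin_coef (w 0) (\<omega> n)\<bar> \<le> E * \<bar>sin_coef (w 0) (\<omega> n)\<bar>"
      using E_mono by (intro mult_right_mono) auto
    finally show ?thesis by simp
  qed
  have sA: "summable A" "suminf A \<le> I"
    unfolding A_def I_def using summable_bessel[OF heat_solution_continuous[OF w]] by auto
  have s\<gamma>: "summable (\<lambda>n. (\<gamma> n)^2 / N n)" unfolding \<gamma>_def by (rule summable_gain)
  obtain w' w'' where w'': "C2_triple (w T) w' w''" "bc (w T) w'"
    using heat_solution_C2[OF w T] by blast
  have "integral {0..1} (\<lambda>z. (w T z)^2) \<le> (\<Sum>n. (sin_coef (w T) (\<omega> n))^2 / N n)"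
    by (rule parseval_le[OF w''])
  also have "\<dots> \<le> (\<Sum>n. (1 + \<epsilon>) * E^2 * A n + (1 + 1 / \<epsilon>) * M^2 * ((\<gamma> n)^2 / N n))"
  proof (rule suminf_le)
    show "summable (\<lambda>n. (sin_coef (w T) (\<omega> n))^2 / N n)"
      by (rule summable_bessel(1)[OF heat_solution_continuous[OF w T]])
    show "summable (\<lambda>n. (1 + \<epsilon>) * E^2 * A n + (1 + 1 / \<epsilon>) * M^2 * ((\<gamma> n)^2 / N n))"
      by (intro summable_add summable_mult sA s\<gamma>)
    fix n
    have "(sin_coef (w T) (\<omega> n))^2 \<le> (E * \<bar>sin_coef (w 0) (\<omega> n)\<bar> + \<gamma> n * M)^2"
      using coef[of n] by (intro abs_le_square_iff[THEN iffD1]) linarith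
    also have "\<dots> \<le> (1 + \<epsilon>) * (E * \<bar>sin_coef (w 0) (\<omega> n)\<bar>)^2 + (1 + 1 / \<epsilon>) * (\<gamma> n * M)^2"
      by (rule square_sum_le_weighted[OF \<epsilon>])
    finally have "(sin_coef (w T) (\<omega> n))^2 / N n \<le>
        ((1 + \<epsilon>) * (E * \<bar>sin_coef (w 0) (\<omega> n)\<bar>)^2 + (1 + 1 / \<epsilon>) * (\<gamma> n * M)^2) / N n"
      using N_pos[of n] by (intro divide_right_mono) auto
    also have "\<dots> = (1 + \<epsilon>) * E^2 * A n + (1 + 1 / \<epsilon>) * M^2 * ((\<gamma> n)^2 / N n)"
      unfolding A_def power_mult_distrib by (simp add: add_divide_distrib mult_ac)
    finally show "(sin_coef (w T) (\<omega> n))^2 / N n \<le> (1 + \<epsilon>) * E^2 * A n + (1 + 1 / \<epsilon>) * M^2 * ((\<gamma> n)^2 / N n)" .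
  qed
  also have "\<dots> = (1 + \<epsilon>) * E^2 * suminf A + (1 + 1 / \<epsilon>) * M^2 * (\<Sum>n. (\<gamma> n)^2 / N n)"
    by (intro sums_unique[symmetric] sums_add sums_mult summable_sums sA s\<gamma>)
  also have "\<dots> \<le> (1 + \<epsilon>) * E^2 * I + (1 + 1 / \<epsilon>) * M^2 * (\<Sum>n. (\<gamma> n)^2 / N n)"
    using sA(2) \<epsilon> by (intro add_right_mono mult_left_mono) auto
  finally have "sqrt (integral {0..1} (\<lambda>z. (w T z)^2))
      \<le> sqrt ((1 + \<epsilon>) * E^2 * I + (1 + 1 / \<epsilon>) * M^2 * (\<Sum>n. (\<gamma> n)^2 / N n))"
    by simp
  also have "\<dots> \<le> sqrt ((1 + \<epsilon>) * E^2 * I) + sqrt ((1 + 1 / \<epsilon>) * M^2 * (\<Sum>n. (\<gamma> n)^2 / N n))"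
  proof (rule sqrt_add_le_add_sqrt)
    have "I \<ge> 0" unfolding I_def
      by (intro integral_nonneg integrable_continuous_real continuous_intros heat_solution_continuous[OF w]) auto
    then show "0 \<le> (1 + \<epsilon>) * E^2 * I" using \<epsilon> by simp
    show "0 \<le> (1 + 1 / \<epsilon>) * M^2 * (\<Sum>n. (\<gamma> n)^2 / N n)"
      using \<epsilon> N_pos by (intro mult_nonneg_nonneg suminf_nonneg s\<gamma>) (auto simp: less_imp_le)
  qed
  also have "\<dots> = E * sqrt ((1 + \<epsilon>) * I) + sqrt (1 + 1 / \<epsilon>) * sqrt (\<Sum>n. (\<gamma> n)^2 / N n) * M"
    using M0 by (simp add: real_sqrt_mult E_def)
  finally show ?thesis by (simp add: E_def I_def \<gamma>_def)
qed

end

section \<open>Existence\<close>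

text \<open>Domination is only local because the bounds for the coefficients below depend on the
  time interval.\<close>

lemma continuous_on_suminf_locally_dominated:
  fixes f :: "nat \<Rightarrow> 'a :: metric_space \<Rightarrow> real"
  assumes cont: "\<And>n. continuous_on S (f n)"
    and dom: "\<And>x. x \<in> S \<Longrightarrow> \<exists>U b. open U \<and> x \<in> U \<and> summable b \<and> (\<forall>n. \<forall>y\<in>U \<inter> S. \<bar>f n y\<bar> \<le> b n)"
  shows "continuous_on S (\<lambda>x. \<Sum>n. f n x)"
  unfolding continuous_on_eq_continuous_within
proof
  fix x assume x: "x \<in> S"
  obtain U b where U: "open U" "x \<in> U" "summable b" "\<And>n y. y \<in> U \<inter> S \<Longrightarrow> \<bar>f n y\<bar> \<le> b n"
    using dom[OF x] by blast
  have "uniform_limit (U \<inter> S) (\<lambda>n y. \<Sum>i<n. f i y) (\<lambda>y. \<Sum>i. f i y) sequentially"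
    using U(3,4) by (intro Weierstrass_m_test[of _ _ b]) auto
  then have "continuous_on (U \<inter> S) (\<lambda>y. \<Sum>i. f i y)"
    by (rule uniform_limit_theorem[rotated])
      (auto intro!: always_eventually continuous_on_sum intro: continuous_on_subset[OF cont])
  then have "continuous (at x within (U \<inter> S)) (\<lambda>y. \<Sum>i. f i y)"
    using x U(2) by (simp add: continuous_on_eq_continuous_within)
  moreover have "at x within (U \<inter> S) = at x within S"
    by (rule at_within_nhd[OF U(2,1)]) auto
  ultimately show "continuous (at x within S) (\<lambda>x. \<Sum>n. f n x)" by simp
qed

lemma has_real_derivative_eq_on:
  fixes f :: "real \<Rightarrow> real"
  assumes "(f has_real_derivative f') (at x within S)" "x \<in> S" "\<And>y. y \<in> S \<Longrightarrow> g y = f y"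
  shows "(g has_real_derivative f') (at x within S)"
  using assms by (intro has_field_derivative_transform_within[OF assms(1) zero_less_one]) auto

lemma has_real_derivative_suminf_dominated:
  fixes f f' :: "nat \<Rightarrow> real \<Rightarrow> real"
  assumes S: "convex S" and x: "x \<in> S"
    and deriv: "\<And>n x. x \<in> S \<Longrightarrow> (f n has_real_derivative f' n x) (at x within S)"
    and b: "summable b" "\<And>n x. x \<in> S \<Longrightarrow> \<bar>f' n x\<bar> \<le> b n"
    and sf: "summable (\<lambda>n. f n x)"
  shows "((\<lambda>x. \<Sum>n. f n x) has_real_derivative (\<Sum>n. f' n x)) (at x within S)"
proof -
  have "uniform_limit S (\<lambda>n x. \<Sum>i<n. f' i x) (\<lambda>x. \<Sum>i. f' i x) sequentially"
    using b by (intro Weierstrass_m_test[of _ _ b]) auto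
  from has_field_derivative_series[OF S deriv this x sf] obtain g where
    g: "\<And>x. x \<in> S \<Longrightarrow> (\<lambda>n. f n x) sums g x"
       "\<And>x. x \<in> S \<Longrightarrow> (g has_real_derivative (\<Sum>i. f' i x)) (at x within S)" by blast
  show ?thesis
    by (rule has_real_derivative_eq_on[OF g(2)[OF x] x]) (use g(1) in \<open>simp add: sums_iff\<close>)
qed

lemma C2_triple_cong:
  assumes "C2_triple f f' f''" "\<And>z. z \<in> {0..1} \<Longrightarrow> g z = f z"
  shows "C2_triple g f' f''"
  using assms unfolding C2_triple_def by (auto intro: has_real_derivative_eq_on)

lemma C2_triple_sinh: "C2_triple (\<lambda>z. sinh (w * z)) (\<lambda>z. w * cosh (w * z)) (\<lambda>z. w^2 * sinh (w * z))"
  unfolding C2_triple_def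
  by (auto intro!: derivative_eq_intros continuous_intros simp: power2_eq_square)

lemma C2_triple_cosh: "C2_triple (\<lambda>z. cosh (w * z)) (\<lambda>z. w * sinh (w * z)) (\<lambda>z. w^2 * cosh (w * z))"
  unfolding C2_triple_def
  by (auto intro!: derivative_eq_intros continuous_intros simp: power2_eq_square)

text \<open>Serves the resonant particular solution in \<open>stationary_lifts\<close>.\<close>

lemma C2_triple_times_id:
  assumes "C2_triple f f' f''"
  shows "C2_triple (\<lambda>z. z * f z) (\<lambda>z. f z + z * f' z) (\<lambda>z. 2 * f' z + z * f'' z)"
  using assms C2_triple_continuous[OF assms] unfolding C2_triple_def
  by (auto intro!: derivative_eq_intros continuous_intros)

lemma mult_exp_neg_le: "x * exp (- x) \<le> (1::real)"
proof -
  have "x \<le> exp x" using exp_ge_add_one_self[of x] by linarith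
  then show ?thesis by (simp add: exp_minus field_simps)
qed

section \<open>Stationary lifts, Duhamel integrals and regularity of sine series\<close>

context robin_system
begin

text \<open>This is the boundary functional of \<open>sinh (\<zeta> * z)\<close>. Being nonzero, it
  allows multiples of this function, which vanishes at 0, to correct the condition at 1.\<close>

lemma bc_kernel_pos:
  assumes "\<zeta> > 0"
  shows "\<beta> * (\<zeta> * cosh \<zeta>) + \<alpha> * sinh \<zeta> > 0"
proof (cases "\<beta> = 0")
  case True
  then show ?thesis using nonneg assms by simp
next
  case False
  then show ?thesis using nonneg assms by (intro add_pos_nonneg mult_pos_pos) auto
qed

lemma stationary_lifts:
  assumes \<zeta>: "\<zeta> > 0" and D: "D > 0"
  obtains \<phi> \<phi>' \<psi> \<psi>' where "C2_triple \<phi> \<phi>' (\<lambda>z. \<zeta>^2 * \<phi> z)" "bc \<phi> \<phi>'" "\<phi> 0 = 1"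
    "C2_triple \<psi> \<psi>' (\<lambda>z. \<zeta>^2 * \<psi> z + \<phi> z / D)" "bc \<psi> \<psi>'" "\<psi> 0 = 0"
proof -
  define \<kappa> where "\<kappa> = \<beta> * (\<zeta> * cosh \<zeta>) + \<alpha> * sinh \<zeta>"
  have \<kappa>: "\<kappa> > 0" unfolding \<kappa>_def by (rule bc_kernel_pos[OF \<zeta>])
  \<comment> \<open>The multiple of \<open>sinh\<close> that makes \<open>\<phi>\<close> satisfy the
    condition at 1.\<close>
  define r where "r = (\<beta> * (\<zeta> * sinh \<zeta>) + \<alpha> * cosh \<zeta>) / \<kappa>"
  define \<phi> where "\<phi> = (\<lambda>z. cosh (\<zeta> * z) - r * sinh (\<zeta> * z))"
  define \<phi>' where "\<phi>' = (\<lambda>z. \<zeta> * sinh (\<zeta> * z) - r * (\<zeta> * cosh (\<zeta> * z)))"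
  have \<phi>: "C2_triple \<phi> \<phi>' (\<lambda>z. \<zeta>^2 * \<phi> z)"
    using C2_triple_diff[OF C2_triple_cosh C2_triple_cmult[OF C2_triple_sinh], of \<zeta> r \<zeta>]
    by (simp add: \<phi>_def \<phi>'_def algebra_simps)
  have "\<beta> * \<phi>' 1 + \<alpha> * \<phi> 1 = (\<beta> * (\<zeta> * sinh \<zeta>) + \<alpha> * cosh \<zeta>) - r * \<kappa>"
    by (simp add: \<phi>_def \<phi>'_def \<kappa>_def algebra_simps)
  then have bc\<phi>: "bc \<phi> \<phi>'" using \<kappa> by (simp add: bc_def r_def)
  \<comment> \<open>As \<open>g' = \<zeta> * \<phi>\<close> and \<open>g'' = \<zeta>^2 * g\<close>,
    the function \<open>z * g z / (2 * \<zeta> * D)\<close> solves the inhomogeneous equation for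
    \<open>\<psi>\<close>; the term with \<open>s\<close> then repairs the condition at 1.\<close>
  define g where "g = (\<lambda>z. sinh (\<zeta> * z) - r * cosh (\<zeta> * z))"
  define g' where "g' = (\<lambda>z. \<zeta> * cosh (\<zeta> * z) - r * (\<zeta> * sinh (\<zeta> * z)))"
  have g: "C2_triple g g' (\<lambda>z. \<zeta>^2 * g z)"
    using C2_triple_diff[OF C2_triple_sinh C2_triple_cmult[OF C2_triple_cosh], of \<zeta> r \<zeta>]
    by (simp add: g_def g'_def algebra_simps)
  define s where "s = (\<beta> * (g 1 + g' 1) + \<alpha> * g 1) / (2 * \<zeta> * D * \<kappa>)"
  define \<psi> where "\<psi> = (\<lambda>z. 1 / (2 * \<zeta> * D) * (z * g z) - s * sinh (\<zeta> * z))"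
  define \<psi>' where "\<psi>' = (\<lambda>z. 1 / (2 * \<zeta> * D) * (g z + z * g' z) - s * (\<zeta> * cosh (\<zeta> * z)))"
  have "C2_triple \<psi> \<psi>' (\<lambda>z. 1 / (2 * \<zeta> * D) * (2 * g' z + z * (\<zeta>^2 * g z)) - s * (\<zeta>^2 * sinh (\<zeta> * z)))"
    unfolding \<psi>_def \<psi>'_def
    by (intro C2_triple_diff C2_triple_cmult C2_triple_times_id g C2_triple_sinh)
  also have "(\<lambda>z. 1 / (2 * \<zeta> * D) * (2 * g' z + z * (\<zeta>^2 * g z)) - s * (\<zeta>^2 * sinh (\<zeta> * z)))
     = (\<lambda>z. \<zeta>^2 * \<psi> z + \<phi> z / D)"
  proof
    fix z
    have "g' z = \<zeta> * \<phi> z" by (simp add: g'_def \<phi>_def algebra_simps)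
    then show "1 / (2 * \<zeta> * D) * (2 * g' z + z * (\<zeta>^2 * g z)) - s * (\<zeta>^2 * sinh (\<zeta> * z))
      = \<zeta>^2 * \<psi> z + \<phi> z / D"
      using \<zeta> D by (simp add: \<psi>_def field_simps)
  qed
  finally have \<psi>: "C2_triple \<psi> \<psi>' (\<lambda>z. \<zeta>^2 * \<psi> z + \<phi> z / D)" .
  have "\<beta> * \<psi>' 1 + \<alpha> * \<psi> 1 = (\<beta> * (g 1 + g' 1) + \<alpha> * g 1) / (2 * \<zeta> * D) - s * \<kappa>"
    using \<zeta> D by (simp add: \<psi>_def \<psi>'_def \<kappa>_def field_simps)
  then have bc\<psi>: "bc \<psi> \<psi>'" using \<kappa> by (simp add: bc_def s_def)
  show ?thesis
    by (rule that[OF \<phi> bc\<phi> _ \<psi> bc\<psi>]) (simp_all add: \<phi>_def \<psi>_def)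
qed

text \<open>The gain of a factor \<open>1 / l\<close> matters: \<open>l\<close> grows like
  \<open>(\<omega> n)^2\<close>, which pays for two spatial derivatives. It follows from
  \<open>linear_ode_bound\<close> with initial value 0.\<close>

lemma duhamel:
  assumes l: "l > 0" and h: "continuous_on {0..} h"
  obtains J where "continuous_on {0..} J" "J 0 = 0"
    "\<And>t. t > 0 \<Longrightarrow> (J has_real_derivative - l * J t + h t) (at t)"
    "\<And>t B. t \<ge> 0 \<Longrightarrow> (\<And>s. s \<in> {0..t} \<Longrightarrow> \<bar>h s\<bar> \<le> B) \<Longrightarrow> \<bar>J t\<bar> \<le> B / l"
proof -
  define J where "J t = exp (- l * t) * integral {0..t} (\<lambda>s. exp (l * s) * h s)" for t
  have int: "((\<lambda>t. integral {0..t} (\<lambda>s. exp (l * s) * h s)) has_real_derivative exp (l * t) * h t) (at t within {0..T})"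
    if "t \<in> {0..T}" for t T
    using that by (intro integral_has_real_derivative continuous_intros continuous_on_subset[OF h]) auto
  have dJ: "(J has_real_derivative - l * J t + h t) (at t within {0..T})" if "t \<in> {0..T}" for t T
  proof -
    have "(J has_real_derivative - l * exp (- l * t) * integral {0..t} (\<lambda>s. exp (l * s) * h s)
        + exp (l * t) * h t * exp (- l * t)) (at t within {0..T})"
      unfolding J_def by (rule derivative_eq_intros int[OF that] refl)+ simp
    also have "- l * exp (- l * t) * integral {0..t} (\<lambda>s. exp (l * s) * h s) + exp (l * t) * h t * exp (- l * t)
       = - l * J t + h t"
      by (simp add: J_def exp_minus)
    finally show ?thesis .
  qed
  have contT: "continuous_on {0..T} J" for T
    by (rule DERIV_continuous_on[OF dJ])
  have cont: "continuous_on {0..} J"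
    unfolding continuous_on_eq_continuous_within
  proof
    fix t :: real assume t: "t \<in> {0..}"
    have "continuous (at t within {0..t + 1}) J"
      using contT[of "t + 1"] t by (simp add: continuous_on_eq_continuous_within)
    moreover have "at t within {0..t + 1} = at t within {0..}"
      by (rule at_within_nhd[of _ "{..<t + 1}"]) auto
    ultimately show "continuous (at t within {0..}) J" by simp
  qed
  have der: "(J has_real_derivative - l * J t + h t) (at t)" if "t > 0" for t
    using dJ[of t "t + 1"] that by (simp add: at_within_Icc_at)
  show ?thesis
  proof (rule that[OF cont _ der])
    show J0: "J 0 = 0" by (simp add: J_def)
    fix t B assume t: "t \<ge> 0" and B: "\<And>s. s \<in> {0..t} \<Longrightarrow> \<bar>h s\<bar> \<le> B"
    have "\<bar>J t\<bar> \<le> exp (- l * t) * \<bar>J 0\<bar> + B / l"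
    proof (rule linear_ode_bound[OF contT t der])
      show "\<bar>h s\<bar> \<le> l * (B / l)" if "0 < s" "s < t" for s using B[of s] that l by simp
      show "0 \<le> B / l" using B[of 0] t l by (intro divide_nonneg_pos) auto
    qed
    then show "\<bar>J t\<bar> \<le> B / l" by (simp add: J0)
  qed
qed

text \<open>Decay of order \<open>1 / (\<omega> n)^2\<close>, locally uniform down to
  \<open>t = 0\<close>, gives continuity up to the initial time. The stronger decay away from
  \<open>t = 0\<close> permits one time derivative and two spatial derivatives.\<close>

lemma sine_series_solution:
  fixes c c' :: "nat \<Rightarrow> real \<Rightarrow> real"
  assumes cont: "\<And>n. continuous_on {0..} (c n)"
    and deriv: "\<And>n t. t > 0 \<Longrightarrow> (c n has_real_derivative c' n t) (at t)"
    and cont': "\<And>n. continuous_on {0<..} (c' n)"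
    and bound: "\<And>T. T \<ge> 0 \<Longrightarrow> \<exists>K. \<forall>n. \<forall>t\<in>{0..T}. \<bar>c n t\<bar> \<le> K / (\<omega> n)^2"
    and bound': "\<And>t0 T. 0 < t0 \<Longrightarrow> \<exists>K. \<forall>n. \<forall>t\<in>{t0..T}.
        (\<omega> n)^2 * \<bar>c n t\<bar> \<le> K / (\<omega> n)^2 \<and> \<bar>c' n t\<bar> \<le> K / (\<omega> n)^2"
  defines "u \<equiv> \<lambda>t z. \<Sum>n. c n t * sin (\<omega> n * z)"
  shows "continuous_on ({0..} \<times> {0..1}) (\<lambda>(t, z). u t z)" (is ?cont)
    and "continuous_on ({0<..} \<times> {0..1}) (\<lambda>(t, z). \<Sum>n. c' n t * sin (\<omega> n * z))" (is ?cont')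
    and "\<And>t z. t > 0 \<Longrightarrow> ((\<lambda>t. u t z) has_real_derivative (\<Sum>n. c' n t * sin (\<omega> n * z))) (at t)"
    and "continuous_on ({0<..} \<times> {0..1}) (\<lambda>(t, z). \<Sum>n. c n t * \<omega> n * cos (\<omega> n * z))" (is ?contz)
    and "\<And>t. t > 0 \<Longrightarrow> C2_triple (u t) (\<lambda>z. \<Sum>n. c n t * \<omega> n * cos (\<omega> n * z))
          (\<lambda>z. \<Sum>n. - (c n t * (\<omega> n)^2 * sin (\<omega> n * z)))" (is "\<And>t. _ \<Longrightarrow> ?C2 t")
    and "\<And>t. t > 0 \<Longrightarrow> bc (u t) (\<lambda>z. \<Sum>n. c n t * \<omega> n * cos (\<omega> n * z))" (is "\<And>t. _ \<Longrightarrow> ?bc t")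
proof -
  have mult_sin: "\<bar>x * sin y\<bar> \<le> b" "\<bar>x * cos y\<bar> \<le> b" if "\<bar>x\<bar> \<le> b" for x y b :: real
  proof -
    have "\<bar>x\<bar> * \<bar>sin y\<bar> \<le> b * 1" "\<bar>x\<bar> * \<bar>cos y\<bar> \<le> b * 1"
      using that by (intro mult_mono; simp)+
    then show "\<bar>x * sin y\<bar> \<le> b" "\<bar>x * cos y\<bar> \<le> b" by (auto simp: abs_mult)
  qed
  show ?cont
    unfolding u_def split_beta
  proof (rule continuous_on_suminf_locally_dominated)
    fix n
    show "continuous_on ({0..} \<times> {0..1}) (\<lambda>x. c n (fst x) * sin (\<omega> n * snd x))"
      by (intro continuous_intros continuous_on_compose2[OF cont]) auto
  next
    fix x :: "real \<times> real" assume x: "x \<in> {0..} \<times> {0..1}"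
    obtain K where K: "\<And>n t. t \<in> {0..fst x + 1} \<Longrightarrow> \<bar>c n t\<bar> \<le> K / (\<omega> n)^2"
      using bound[of "fst x + 1"] x by force
    show "\<exists>U b. open U \<and> x \<in> U \<and> summable b \<and>
        (\<forall>n. \<forall>y\<in>U \<inter> {0..} \<times> {0..1}. \<bar>c n (fst y) * sin (\<omega> n * snd y)\<bar> \<le> b n)"
      by (rule exI[of _ "{..<fst x + 1} \<times> UNIV"], rule exI[of _ "\<lambda>n. K / (\<omega> n)^2"])
        (auto simp: mem_Times_iff intro!: open_Times summable_inverse_\<omega>_square mult_sin K)
  qed
  show ?cont'
    unfolding split_beta
  proof (rule continuous_on_suminf_locally_dominated)
    fix n
    show "continuous_on ({0<..} \<times> {0..1}) (\<lambda>x. c' n (fst x) * sin (\<omega> n * snd x))"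
      by (intro continuous_intros continuous_on_compose2[OF cont']) auto
  next
    fix x :: "real \<times> real" assume x: "x \<in> {0<..} \<times> {0..1}"
    obtain K where K: "\<And>n t. t \<in> {fst x / 2..fst x + 1} \<Longrightarrow> \<bar>c' n t\<bar> \<le> K / (\<omega> n)^2"
      using bound'[of "fst x / 2" "fst x + 1"] x by force
    show "\<exists>U b. open U \<and> x \<in> U \<and> summable b \<and>
        (\<forall>n. \<forall>y\<in>U \<inter> {0<..} \<times> {0..1}. \<bar>c' n (fst y) * sin (\<omega> n * snd y)\<bar> \<le> b n)"
      by (rule exI[of _ "{fst x / 2<..<fst x + 1} \<times> UNIV"], rule exI[of _ "\<lambda>n. K / (\<omega> n)^2"])
        (use x in \<open>auto simp: mem_Times_iff intro!: open_Times summable_inverse_\<omega>_square mult_sin K\<close>)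
  qed
  have summable_dom: "summable f" if "\<And>n. \<bar>f n\<bar> \<le> K / (\<omega> n)^2" for f :: "nat \<Rightarrow> real" and K
    using that by (intro summable_comparison_test'[OF summable_inverse_\<omega>_square[of K]]) auto
  have sum_u: "summable (\<lambda>n. c n t * sin (\<omega> n * z))" if t: "t > 0" for t z
  proof -
    obtain K where K: "\<And>n. \<bar>c n t\<bar> \<le> K / (\<omega> n)^2" using bound[of t] t by force
    show ?thesis by (rule summable_dom[OF mult_sin(1)[OF K]])
  qed
  show "((\<lambda>t. u t z) has_real_derivative (\<Sum>n. c' n t * sin (\<omega> n * z))) (at t)" if t: "t > 0" for t z
  proof -
    obtain K where K: "\<And>n s. s \<in> {t / 2..t + 1} \<Longrightarrow> \<bar>c' n s\<bar> \<le> K / (\<omega> n)^2"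
      using bound'[of "t / 2" "t + 1"] t by force
    have "((\<lambda>t. \<Sum>n. c n t * sin (\<omega> n * z)) has_real_derivative (\<Sum>n. c' n t * sin (\<omega> n * z))) (at t within {t/2<..<t+1})"
    proof (rule has_real_derivative_suminf_dominated[OF _ _ _ summable_inverse_\<omega>_square[of K]])
      show "((\<lambda>t. c n t * sin (\<omega> n * z)) has_real_derivative c' n s * sin (\<omega> n * z)) (at s within {t/2<..<t+1})"
        if "s \<in> {t/2<..<t+1}" for n s
        using deriv[of s n] that t by (intro DERIV_cmult_right) (auto intro: DERIV_subset)
      show "\<bar>c' n s * sin (\<omega> n * z)\<bar> \<le> K / (\<omega> n)^2" if "s \<in> {t/2<..<t+1}" for n s
        using that by (intro mult_sin K) auto
    qed (use t sum_u in auto)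
    then show ?thesis using t by (simp add: u_def at_within_open[of t "{t/2<..<t+1}"])
  qed
  \<comment> \<open>Since \<open>\<omega> n >= 1\<close>, the bound for two spatial derivatives also
    covers one.\<close>
  have c\<omega>: "\<bar>c n t * \<omega> n\<bar> \<le> (\<omega> n)^2 * \<bar>c n t\<bar>" for n t
  proof -
    have "\<omega> n * \<bar>c n t\<bar> \<le> (\<omega> n)^2 * \<bar>c n t\<bar>"
      using \<omega>_ge[of n] by (intro mult_right_mono) (auto simp: power2_eq_square)
    with \<omega>_pos[of n] show ?thesis by (simp add: abs_mult mult.commute)
  qed
  show ?contz
    unfolding split_beta
  proof (rule continuous_on_suminf_locally_dominated)
    fix n
    show "continuous_on ({0<..} \<times> {0..1}) (\<lambda>x. c n (fst x) * \<omega> n * cos (\<omega> n * snd x))"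
      by (intro continuous_intros continuous_on_compose2[OF cont]) auto
  next
    fix x :: "real \<times> real" assume x: "x \<in> {0<..} \<times> {0..1}"
    obtain K where K: "\<And>n t. t \<in> {fst x / 2..fst x + 1} \<Longrightarrow> (\<omega> n)^2 * \<bar>c n t\<bar> \<le> K / (\<omega> n)^2"
      using bound'[of "fst x / 2" "fst x + 1"] x by force
    show "\<exists>U b. open U \<and> x \<in> U \<and> summable b \<and>
        (\<forall>n. \<forall>y\<in>U \<inter> {0<..} \<times> {0..1}. \<bar>c n (fst y) * \<omega> n * cos (\<omega> n * snd y)\<bar> \<le> b n)"
      by (rule exI[of _ "{fst x / 2<..<fst x + 1} \<times> UNIV"], rule exI[of _ "\<lambda>n. K / (\<omega> n)^2"])
        (use x in \<open>auto simp: mem_Times_iff intro!: open_Times summable_inverse_\<omega>_square mult_sin order.trans[OF c\<omega> K]\<close>)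
  qed
  have "?C2 t \<and> ?bc t" if t: "t > 0" for t
  proof -
    \<comment> \<open>A single time is concerned, so the degenerate interval from \<open>t\<close>
      to \<open>t\<close> suffices.\<close>
    obtain K where K2: "\<And>n. (\<omega> n)^2 * \<bar>c n t\<bar> \<le> K / (\<omega> n)^2"
      using bound'[of t t] t by force
    have K1: "\<bar>c n t * \<omega> n\<bar> \<le> K / (\<omega> n)^2" for n
      by (rule order.trans[OF c\<omega> K2])
    have K2': "\<bar>c n t * (\<omega> n)^2\<bar> \<le> K / (\<omega> n)^2" for n using K2[of n] by (simp add: abs_mult mult.commute)
    define u' where "u' = (\<lambda>z. \<Sum>n. c n t * \<omega> n * cos (\<omega> n * z))"
    have sum_u': "summable (\<lambda>n. c n t * \<omega> n * cos (\<omega> n * z))" for z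
      by (rule summable_dom[OF mult_sin(2)[OF K1]])
    have "C2_triple (u t) u' (\<lambda>z. \<Sum>n. - (c n t * (\<omega> n)^2 * sin (\<omega> n * z)))"
      unfolding C2_triple_def
    proof (intro conjI ballI)
      fix z :: real assume z: "z \<in> {0..1}"
      show "(u t has_real_derivative u' z) (at z within {0..1})"
        unfolding u_def u'_def
      proof (rule has_real_derivative_suminf_dominated[OF _ z _ summable_inverse_\<omega>_square[of K]])
        show "((\<lambda>z. c n t * sin (\<omega> n * z)) has_real_derivative c n t * \<omega> n * cos (\<omega> n * z)) (at z within {0..1})" for n z
          by (auto intro!: derivative_eq_intros)
      qed (use mult_sin(2)[OF K1] sum_u[OF t] in auto)
      show "(u' has_real_derivative (\<Sum>n. - (c n t * (\<omega> n)^2 * sin (\<omega> n * z)))) (at z within {0..1})"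
        unfolding u'_def
      proof (rule has_real_derivative_suminf_dominated[OF _ z _ summable_inverse_\<omega>_square[of K]])
        show "((\<lambda>z. c n t * \<omega> n * cos (\<omega> n * z)) has_real_derivative - (c n t * (\<omega> n)^2 * sin (\<omega> n * z))) (at z within {0..1})" for n z
          by (auto intro!: derivative_eq_intros simp: power2_eq_square)
      qed (use mult_sin(1)[OF K2'] sum_u' in auto)
    next
      show "continuous_on {0..1} (\<lambda>z. \<Sum>n. - (c n t * (\<omega> n)^2 * sin (\<omega> n * z)))"
      proof (rule continuous_on_suminf_locally_dominated)
        fix x :: real
        show "\<exists>U b. open U \<and> x \<in> U \<and> summable b \<and> (\<forall>n. \<forall>y\<in>U \<inter> {0..1}. \<bar>- (c n t * (\<omega> n)^2 * sin (\<omega> n * y))\<bar> \<le> b n)"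
          by (rule exI[of _ UNIV], rule exI[of _ "\<lambda>n. K / (\<omega> n)^2"])
            (use mult_sin(1)[OF K2'] summable_inverse_\<omega>_square in auto)
      qed (intro continuous_intros)
    qed
    moreover have "bc (u t) u'"
    proof -
      have "\<beta> * u' 1 + \<alpha> * u t 1 = (\<Sum>n. \<beta> * (c n t * \<omega> n * cos (\<omega> n * 1)) + \<alpha> * (c n t * sin (\<omega> n * 1)))"
        unfolding u_def u'_def
        by (intro sums_unique sums_add sums_mult summable_sums sum_u' sum_u t)
      also have "\<dots> = (\<Sum>n. c n t * (\<beta> * (\<omega> n * cos (\<omega> n)) + \<alpha> * sin (\<omega> n)))"
        by (simp add: algebra_simps)
      also have "\<dots> = 0" by (simp add: eigen)
      finally show ?thesis by (simp add: bc_def)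
    qed
    ultimately show ?thesis unfolding u'_def by blast
  qed
  then show "\<And>t. t > 0 \<Longrightarrow> ?C2 t" "\<And>t. t > 0 \<Longrightarrow> ?bc t" by blast+
qed

end

context robin_system
begin

lemma summable_inverse_\<omega>_square_dominated:
  assumes "\<And>n. \<bar>f n\<bar> \<le> K / (\<omega> n)^2"
  shows "summable (\<lambda>n. f n * sin (\<omega> n * z))"
proof (rule summable_comparison_test'[OF summable_inverse_\<omega>_square[of K]])
  fix n
  have "\<bar>f n\<bar> * \<bar>sin (\<omega> n * z)\<bar> \<le> K / (\<omega> n)^2 * 1"
    using assms[of n] by (intro mult_mono) auto
  then show "norm (f n * sin (\<omega> n * z)) \<le> K / (\<omega> n)^2" by (simp add: abs_mult)
qed

text \<open>The spatial derivative \<open>wz\<close> is delivered separately because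
  \<open>C1_on_Times\<close> demands its joint continuity, which \<open>heat_solution\<close> does
  not record.\<close>

lemma heat_solution_exists:
  assumes D: "D > 0" and \<zeta>: "\<zeta> > 0"
    and d: "\<And>t. t \<ge> 0 \<Longrightarrow> (d has_real_derivative d' t) (at t within {0..})"
    and d': "\<And>t. t \<ge> 0 \<Longrightarrow> (d' has_real_derivative d'' t) (at t within {0..})"
    and d'': "continuous_on {0..} d''"
    and w0: "C2_triple w0 w0' w0''" "bc w0 w0'" "w0 0 = d 0"
  obtains w wz where "heat_solution D \<zeta> d w" "\<And>z. z \<in> {0..1} \<Longrightarrow> w 0 z = w0 z"
    "\<And>t z. t > 0 \<Longrightarrow> z \<in> {0..1} \<Longrightarrow> (w t has_real_derivative wz t z) (at z within {0..1})"
    "continuous_on ({0<..} \<times> {0..1}) (\<lambda>(t, z). wz t z)"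
proof -
  \<comment> \<open>Lifting by \<open>\<phi>\<close> alone would leave the source
    \<open>- d' * \<phi>\<close>, whose coefficients decay only like \<open>1 / \<omega> n\<close>
    because \<open>\<phi> 0 = 1\<close>. The second lift replaces it by
    \<open>- d'' * \<psi>\<close>, with coefficients of order
    \<open>1 / (\<omega> n)^2\<close>.\<close>
  obtain \<phi> \<phi>' \<psi> \<psi>' where
    \<phi>: "C2_triple \<phi> \<phi>' (\<lambda>z. \<zeta>^2 * \<phi> z)" "bc \<phi> \<phi>'" "\<phi> 0 = 1" and
    \<psi>: "C2_triple \<psi> \<psi>' (\<lambda>z. \<zeta>^2 * \<psi> z + \<phi> z / D)" "bc \<psi> \<psi>'" "\<psi> 0 = 0"
    using stationary_lifts[OF \<zeta> D] by blast
  have bc_comb: "bc (\<lambda>z. x * f z + y * g z + h z) (\<lambda>z. x * f' z + y * g' z + h' z)"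
    if "bc f f'" "bc g g'" "bc h h'" for f f' g g' h h' and x y :: real
  proof -
    have "\<beta> * (x * f' 1 + y * g' 1 + h' 1) + \<alpha> * (x * f 1 + y * g 1 + h 1)
       = x * (\<beta> * f' 1 + \<alpha> * f 1) + y * (\<beta> * g' 1 + \<alpha> * g 1) + (\<beta> * h' 1 + \<alpha> * h 1)"
      by (simp add: algebra_simps)
    then show ?thesis using that by (simp add: bc_def)
  qed
  \<comment> \<open>Initial value of the remainder; compatibility of \<open>w0\<close> and
    \<open>d\<close> makes it vanish at 0.\<close>
  define u0 where "u0 = (\<lambda>z. - d 0 * \<phi> z + - d' 0 * \<psi> z + w0 z)"
  define u0' where "u0' = (\<lambda>z. - d 0 * \<phi>' z + - d' 0 * \<psi>' z + w0' z)"
  define u0'' where "u0'' = (\<lambda>z. - d 0 * (\<zeta>^2 * \<phi> z) + - d' 0 * (\<zeta>^2 * \<psi> z + \<phi> z / D) + w0'' z)"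
  have u0: "C2_triple u0 u0' u0''" "bc u0 u0'" "u0 0 = 0"
    unfolding u0_def u0'_def u0''_def
    by (intro C2_triple_add C2_triple_cmult \<phi> \<psi> w0) (intro bc_comb \<phi> \<psi> w0, simp add: \<phi> \<psi> w0)
  define p where "p n = sin_coef u0 (\<omega> n) / N n" for n
  define q where "q n = sin_coef \<psi> (\<omega> n) / N n" for n
  obtain Cp where Cp: "Cp > 0" "\<And>n. \<bar>p n\<bar> \<le> Cp / (\<omega> n)^2"
    using nice_coef_bound[OF u0] unfolding p_def by blast
  obtain Cq where Cq: "Cq > 0" "\<And>n. \<bar>q n\<bar> \<le> Cq / (\<omega> n)^2"
    using nice_coef_bound[OF \<psi>] unfolding q_def by blast
  define l where "l n = D * (\<zeta>^2 + (\<omega> n)^2)" for n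
  have l_ge: "D * \<zeta>^2 \<le> l n" "D * (\<omega> n)^2 \<le> l n" and l_pos: "l n > 0" for n
    using D \<omega>_pos[of n] by (auto simp: l_def intro!: mult_pos_pos add_nonneg_pos)
  have "\<exists>J. continuous_on {0..} J \<and> J 0 = 0 \<and>
      (\<forall>t>0. (J has_real_derivative - l n * J t + d'' t) (at t)) \<and>
      (\<forall>t\<ge>0. \<forall>B. (\<forall>s\<in>{0..t}. \<bar>d'' s\<bar> \<le> B) \<longrightarrow> \<bar>J t\<bar> \<le> B / l n)" for n
    by (rule duhamel[OF l_pos[of n] d'']) blast
  then obtain J where J: "\<And>n. continuous_on {0..} (J n)" "\<And>n. J n 0 = 0"
      "\<And>n t. t > 0 \<Longrightarrow> (J n has_real_derivative - l n * J n t + d'' t) (at t)"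
      "\<And>n t B. t \<ge> 0 \<Longrightarrow> (\<forall>s\<in>{0..t}. \<bar>d'' s\<bar> \<le> B) \<Longrightarrow> \<bar>J n t\<bar> \<le> B / l n"
    by metis
  \<comment> \<open>The solution of \<open>c' = - l * c - q * d''\<close> with initial value
    \<open>p\<close>.\<close>
  define c where "c n t = exp (- l n * t) * p n - q n * J n t" for n t
  define c' where "c' n t = - l n * c n t - q n * d'' t" for n t
  have d''_bound: "\<exists>B\<ge>0. \<forall>s\<in>{0..T}. \<bar>d'' s\<bar> \<le> B" for T
    using continuous_on_Icc_bound[OF continuous_on_subset[OF d'', of "{0..T}"]]
    by (metis atLeastAtMost_iff atLeast_iff less_imp_le subsetI)
  have c_cont: "continuous_on {0..} (c n)" for n
    unfolding c_def by (intro continuous_intros J)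
  have c_der: "(c n has_real_derivative c' n t) (at t)" if "t > 0" for n t
    unfolding c_def c'_def using J(3)[OF that]
    by (auto intro!: derivative_eq_intros simp: algebra_simps)
  have c'_cont: "continuous_on {0<..} (c' n)" for n
    unfolding c'_def
    by (intro continuous_intros continuous_on_subset[OF c_cont] continuous_on_subset[OF d'']) auto
  have c_bound: "\<exists>K. \<forall>n. \<forall>t\<in>{0..T}. \<bar>c n t\<bar> \<le> K / (\<omega> n)^2" for T
  proof -
    obtain B where B: "B \<ge> 0" "\<And>s. s \<in> {0..T} \<Longrightarrow> \<bar>d'' s\<bar> \<le> B" using d''_bound by blast
    have "\<bar>c n t\<bar> \<le> (Cp + Cq * (B / (D * \<zeta>^2))) / (\<omega> n)^2" if t: "t \<in> {0..T}" for n t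
    proof -
      have "\<bar>J n t\<bar> \<le> B / l n" using t B(2) by (intro J(4)) auto
      also have "\<dots> \<le> B / (D * \<zeta>^2)"
        using l_ge(1)[of n] D \<zeta> B(1) l_pos[of n] by (intro divide_left_mono) auto
      finally have "\<bar>q n\<bar> * \<bar>J n t\<bar> \<le> Cq / (\<omega> n)^2 * (B / (D * \<zeta>^2))"
        using Cq by (intro mult_mono) auto
      moreover have "exp (- l n * t) * \<bar>p n\<bar> \<le> 1 * (Cp / (\<omega> n)^2)"
        using Cp(2)[of n] t l_pos[of n] by (intro mult_mono) auto
      moreover have "\<bar>c n t\<bar> \<le> exp (- l n * t) * \<bar>p n\<bar> + \<bar>q n\<bar> * \<bar>J n t\<bar>"
        unfolding c_def using abs_triangle_ineq4[of "exp (- l n * t) * p n" "q n * J n t"]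
        by (simp add: abs_mult)
      ultimately show ?thesis by (simp add: add_divide_distrib mult_ac)
    qed
    then show ?thesis by blast
  qed
  have c_bound': "\<exists>K. \<forall>n. \<forall>t\<in>{t0..T}. (\<omega> n)^2 * \<bar>c n t\<bar> \<le> K / (\<omega> n)^2 \<and> \<bar>c' n t\<bar> \<le> K / (\<omega> n)^2"
    if t0: "0 < t0" for t0 T
  proof -
    obtain B where B: "B \<ge> 0" "\<And>s. s \<in> {0..T} \<Longrightarrow> \<bar>d'' s\<bar> \<le> B" using d''_bound by blast
    \<comment> \<open>\<open>K1 / (\<omega> n)^2\<close> bounds \<open>l n * |c n t|\<close>: the
      factor \<open>1 / t0\<close> comes from \<open>l * exp (- l * t) <= 1 / t\<close>, the factor
      \<open>B\<close> from the Duhamel gain. \<open>K\<close> also absorbs the division by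
      \<open>D\<close> and the source term in \<open>c'\<close>.\<close>
    define K1 where "K1 = Cp / t0 + Cq * B"
    define K where "K = K1 / D + K1 + Cq * B"
    have K1: "K1 \<ge> 0" unfolding K1_def using Cp Cq B t0 by auto
    have K: "K1 / D \<le> K" "K1 + Cq * B \<le> K"
      unfolding K_def using K1 D Cq B by auto
    have "(\<omega> n)^2 * \<bar>c n t\<bar> \<le> K / (\<omega> n)^2 \<and> \<bar>c' n t\<bar> \<le> K / (\<omega> n)^2" if t: "t \<in> {t0..T}" for n t
    proof -
      have tp: "t > 0" using t t0 by simp
      have \<omega>2: "(\<omega> n)^2 > 0" using \<omega>_pos[of n] by simp
      have "\<bar>J n t\<bar> \<le> B / l n" using t t0 B(2) by (intro J(4)) auto
      then have "\<bar>q n\<bar> * (l n * \<bar>J n t\<bar>) \<le> Cq / (\<omega> n)^2 * B"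
        using l_pos[of n] Cq by (intro mult_mono) (auto simp: field_simps)
      moreover have "(l n * exp (- l n * t)) * \<bar>p n\<bar> \<le> 1 / t0 * (Cp / (\<omega> n)^2)"
      proof (rule mult_mono)
        have "l n * exp (- l n * t) \<le> 1 / t"
          using mult_exp_neg_le[of "l n * t"] tp by (simp add: field_simps)
        also have "\<dots> \<le> 1 / t0" using t t0 by (simp add: frac_le)
        finally show "l n * exp (- l n * t) \<le> 1 / t0" .
      qed (use Cp t0 in auto)
      moreover have "l n * \<bar>c n t\<bar> \<le> (l n * exp (- l n * t)) * \<bar>p n\<bar> + \<bar>q n\<bar> * (l n * \<bar>J n t\<bar>)"
      proof -
        have "\<bar>c n t\<bar> \<le> exp (- l n * t) * \<bar>p n\<bar> + \<bar>q n\<bar> * \<bar>J n t\<bar>"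
          unfolding c_def using abs_triangle_ineq4[of "exp (- l n * t) * p n" "q n * J n t"]
          by (simp add: abs_mult)
        then have "l n * \<bar>c n t\<bar> \<le> l n * (exp (- l n * t) * \<bar>p n\<bar> + \<bar>q n\<bar> * \<bar>J n t\<bar>)"
          using l_pos[of n] by (intro mult_left_mono) auto
        then show ?thesis by (simp only: distrib_left mult_ac)
      qed
      ultimately have lc: "l n * \<bar>c n t\<bar> \<le> K1 / (\<omega> n)^2"
        by (simp add: K1_def add_divide_distrib)
      have "D * ((\<omega> n)^2 * \<bar>c n t\<bar>) \<le> l n * \<bar>c n t\<bar>"
        using mult_right_mono[OF l_ge(2)[of n], of "\<bar>c n t\<bar>"] by (simp add: mult.assoc)
      with lc have "D * ((\<omega> n)^2 * \<bar>c n t\<bar>) \<le> K1 / (\<omega> n)^2" by linarith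
      then have "(\<omega> n)^2 * \<bar>c n t\<bar> \<le> (K1 / (\<omega> n)^2) / D" 
        by (simp only: pos_le_divide_eq[OF D] mult.commute[of D])
      also have "\<dots> = (K1 / D) / (\<omega> n)^2" by simp
      also have "\<dots> \<le> K / (\<omega> n)^2" using K(1) by (rule divide_right_mono) simp
      finally have 1: "(\<omega> n)^2 * \<bar>c n t\<bar> \<le> K / (\<omega> n)^2" .
      have "\<bar>q n\<bar> * \<bar>d'' t\<bar> \<le> Cq / (\<omega> n)^2 * B"
        using Cq B t t0 by (intro mult_mono) auto
      moreover have "\<bar>c' n t\<bar> \<le> l n * \<bar>c n t\<bar> + \<bar>q n\<bar> * \<bar>d'' t\<bar>"
        unfolding c'_def using abs_triangle_ineq4[of "- l n * c n t" "q n * d'' t"] l_pos[of n]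
        by (simp add: abs_mult)
      ultimately have "\<bar>c' n t\<bar> \<le> (K1 + Cq * B) / (\<omega> n)^2" using lc by (simp add: add_divide_distrib)
      also have "\<dots> \<le> K / (\<omega> n)^2" using K(2) by (rule divide_right_mono) simp
      finally show ?thesis using 1 by simp
    qed
    then show ?thesis by blast
  qed
  define u where "u t z = (\<Sum>n. c n t * sin (\<omega> n * z))" for t z
  define ut where "ut t z = (\<Sum>n. c' n t * sin (\<omega> n * z))" for t z
  define uz where "uz t z = (\<Sum>n. c n t * \<omega> n * cos (\<omega> n * z))" for t z
  define uzz where "uzz t z = (\<Sum>n. - (c n t * (\<omega> n)^2 * sin (\<omega> n * z)))" for t z
  note sol = sine_series_solution[OF c_cont c_der c'_cont c_bound c_bound', folded u_def ut_def uz_def uzz_def]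
  have u_cont: "continuous_on ({0..} \<times> {0..1}) (\<lambda>(t, z). u t z)"
    and ut_cont: "continuous_on ({0<..} \<times> {0..1}) (\<lambda>(t, z). ut t z)"
    and u_der: "\<And>t z. t > 0 \<Longrightarrow> ((\<lambda>t. u t z) has_real_derivative ut t z) (at t)"
    and uz_cont: "continuous_on ({0<..} \<times> {0..1}) (\<lambda>(t, z). uz t z)"
    and u_C2: "\<And>t. t > 0 \<Longrightarrow> C2_triple (u t) (uz t) (uzz t)"
    and u_bc: "\<And>t. t > 0 \<Longrightarrow> bc (u t) (uz t)"
    using sol by blast+
  have ut_eq: "ut t z = D * (uzz t z - \<zeta>^2 * u t z) - d'' t * \<psi> z" if t: "t > 0" and z: "z \<in> {0..1}" for t z
  proof -
    obtain K where K: "\<And>n. (\<omega> n)^2 * \<bar>c n t\<bar> \<le> K / (\<omega> n)^2" using c_bound'[OF t, of t] by auto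
    obtain K' where K': "\<And>n. \<bar>c n t\<bar> \<le> K' / (\<omega> n)^2" using c_bound[of t] t by force
    have s1: "summable (\<lambda>n. c n t * (\<omega> n)^2 * sin (\<omega> n * z))"
      using K by (intro summable_inverse_\<omega>_square_dominated) (simp add: abs_mult mult.commute)
    have s2: "summable (\<lambda>n. c n t * sin (\<omega> n * z))"
      by (rule summable_inverse_\<omega>_square_dominated[OF K'])
    have s3: "summable (\<lambda>n. q n * sin (\<omega> n * z))"
      by (rule summable_inverse_\<omega>_square_dominated[OF Cq(2)])
    \<comment> \<open>Termwise this is the equation for \<open>c'\<close>, and
      \<open>nice_expansion\<close> sums the series of the \<open>q n\<close> to
      \<open>\<psi> z\<close>.\<close>
    have "D * (uzz t z - \<zeta>^2 * u t z) - d'' t * (\<Sum>n. q n * sin (\<omega> n * z))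
      = (\<Sum>n. D * (- (c n t * (\<omega> n)^2 * sin (\<omega> n * z)) - \<zeta>^2 * (c n t * sin (\<omega> n * z))) - d'' t * (q n * sin (\<omega> n * z)))"
      unfolding uzz_def u_def
      by (intro sums_unique sums_diff sums_mult sums_minus summable_sums summable_minus s1 s2 s3)
    also have "\<dots> = ut t z"
      unfolding ut_def c'_def l_def by (intro suminf_cong) (simp add: algebra_simps)
    finally show ?thesis using nice_expansion(2)[OF \<psi> z] by (simp add: q_def)
  qed
  define w where "w t z = d t * \<phi> z + d' t * \<psi> z + u t z" for t z
  define wt where "wt t z = d' t * \<phi> z + d'' t * \<psi> z + ut t z" for t z
  define wz where "wz t z = d t * \<phi>' z + d' t * \<psi>' z + uz t z" for t z
  note c\<phi> = C2_triple_continuous(1)[OF \<phi>(1)] and c\<psi> = C2_triple_continuous(1)[OF \<psi>(1)]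
  have cd: "continuous_on {0..} d" "continuous_on {0..} d'"
    using d d' by (auto intro: DERIV_continuous_on)
  have w0_eq: "w 0 z = w0 z" if "z \<in> {0..1}" for z
  proof -
    have "u 0 z = u0 z" using nice_expansion(2)[OF u0 that] by (simp add: u_def c_def J p_def)
    then show ?thesis by (simp add: w_def u0_def)
  qed
  have "heat_solution D \<zeta> d w"
    unfolding heat_solution_def
  proof (intro conjI exI[of _ wt] allI impI ballI)
    show "continuous_on ({0..} \<times> {0..1}) (\<lambda>(t, z). w t z)"
      using u_cont unfolding w_def split_beta
      by (intro continuous_intros continuous_on_compose2[OF cd(1)] continuous_on_compose2[OF cd(2)]
          continuous_on_compose2[OF c\<phi>] continuous_on_compose2[OF c\<psi>]) auto
    show "continuous_on ({0<..} \<times> {0..1}) (\<lambda>(t, z). wt t z)"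
      using ut_cont unfolding wt_def split_beta
      by (intro continuous_intros continuous_on_compose2[OF cd(2)] continuous_on_compose2[OF d'']
          continuous_on_compose2[OF c\<phi>] continuous_on_compose2[OF c\<psi>]) auto
  next
    fix t z :: real assume t: "0 < t" and z: "z \<in> {0..1}"
    have at: "at t within {0..} = at t" by (rule at_within_interior) (use t in simp)
    note dt = d[of t, unfolded at] d'[of t, unfolded at]
    show "((\<lambda>s. w s z) has_real_derivative wt t z) (at t)"
      unfolding w_def wt_def
      by (rule DERIV_add[OF DERIV_add[OF DERIV_cmult_right[OF dt(1)] DERIV_cmult_right[OF dt(2)]] u_der])
        (use t in simp_all)
  next
    fix t :: real assume "0 \<le> t"
    show "\<exists>w' w''. C2_triple (w t) w' w'' \<and> bc (w t) w' \<and>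
      (0 < t \<longrightarrow> (\<forall>z\<in>{0<..<1}. wt t z = D * (w'' z - \<zeta>^2 * w t z)))"
    proof (cases "t = 0")
      case True
      have "C2_triple (w 0) w0' w0''" by (rule C2_triple_cong[OF w0(1) w0_eq])
      moreover have "bc (w 0) w0'" using w0(2) w0_eq[of 1] by (simp add: bc_def)
      ultimately show ?thesis using True by blast
    next
      case False
      with \<open>0 \<le> t\<close> have t: "t > 0" by simp
      define w'' where "w'' = (\<lambda>z. d t * (\<zeta>^2 * \<phi> z) + d' t * (\<zeta>^2 * \<psi> z + \<phi> z / D) + uzz t z)"
      have "C2_triple (w t) (wz t) w''"
        unfolding w_def[abs_def] wz_def[abs_def] w''_def
        by (intro C2_triple_add C2_triple_cmult \<phi> \<psi> u_C2[OF t])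
      moreover have "bc (w t) (wz t)"
        unfolding w_def[abs_def] wz_def[abs_def] by (intro bc_comb \<phi> \<psi> u_bc[OF t])
      moreover have "wt t z = D * (w'' z - \<zeta>^2 * w t z)" if "z \<in> {0<..<1}" for z
      proof -
        have "D * (w'' z - \<zeta>^2 * w t z) = d' t * \<phi> z + D * (uzz t z - \<zeta>^2 * u t z)"
          using D by (simp add: w''_def w_def algebra_simps)
        then show ?thesis using ut_eq[OF t, of z] that by (simp add: wt_def)
      qed
      ultimately show ?thesis by blast
    qed
  next
    fix t :: real assume "0 \<le> t"
    show "w t 0 = d t" by (simp add: w_def \<phi> \<psi> u_def)
  qed
  moreover have "(w t has_real_derivative wz t z) (at z within {0..1})" if "t > 0" "z \<in> {0..1}" for t z
    using \<phi>(1) \<psi>(1) u_C2[OF that(1)] that(2) unfolding w_def[abs_def] wz_def C2_triple_def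
    by (intro DERIV_add DERIV_cmult) auto
  moreover have "continuous_on ({0<..} \<times> {0..1}) (\<lambda>(t, z). wz t z)"
    using uz_cont unfolding wz_def split_beta
    by (intro continuous_intros continuous_on_compose2[OF cd(1)] continuous_on_compose2[OF cd(2)]
        continuous_on_compose2[OF C2_triple_continuous(2)[OF \<phi>(1)]]
        continuous_on_compose2[OF C2_triple_continuous(2)[OF \<psi>(1)]]) auto
  ultimately show ?thesis using w0_eq that by blast
qed

end

section \<open>The numbers \<open>\<mu>\<^sub>n(a)\<close> and the original equation\<close>

text \<open>Subtracting from \<open>n * pi\<close> multiplies the whole equation by a sign. The
  right-hand form is the defining equation of \<open>mu\<close> cleared of the tangent, which also
  makes sense for \<mu> = 1/2.\<close>

lemma robin_frequency_iff:
  fixes \<mu> b :: real and n :: nat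
  shows "(real n - \<mu>) * pi * cos ((real n - \<mu>) * pi) + b * sin ((real n - \<mu>) * pi) = 0
    \<longleftrightarrow> (real n - \<mu>) * pi * cos (\<mu> * pi) = b * sin (\<mu> * pi)"
proof -
  have "cos ((real n - \<mu>) * pi) = (-1)^n * cos (\<mu> * pi)" "sin ((real n - \<mu>) * pi) = - ((-1)^n * sin (\<mu> * pi))"
    by (simp_all add: left_diff_distrib cos_diff sin_diff)
  then have "(real n - \<mu>) * pi * cos ((real n - \<mu>) * pi) + b * sin ((real n - \<mu>) * pi)
     = (-1)^n * ((real n - \<mu>) * pi * cos (\<mu> * pi) - b * sin (\<mu> * pi))"
    by (simp add: algebra_simps)
  then show ?thesis by simp
qed

lemma enn2real_pos:
  assumes "a \<noteq> \<infinity>" "a \<noteq> 0" shows "enn2real a > 0"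
  using assms by (simp add: enn2real_positive_iff top.not_eq_extremum zero_less_iff_neq_zero)

lemma mu_root:
  assumes a: "a \<noteq> \<infinity>" and n: "1 \<le> n"
  shows "(real n - mu a n) * pi * cos (mu a n * pi) = enn2real a * sin (mu a n * pi)"
proof (cases "a = 0")
  case True
  then show ?thesis by (simp add: mu_def)
next
  case False
  note pos = enn2real_pos[OF a False]
  from theI'[OF mu_unique_root[OF pos n]] a False
  have mu: "0 < mu a n" "mu a n < 1/2"
    "tan (mu a n * pi) + mu a n * pi / enn2real a = real n * pi / enn2real a"
    by (simp_all add: mu_def)
  have "cos (mu a n * pi) > 0"
    using mu(1,2) by (intro cos_gt_zero_pi) (auto intro: order.strict_trans[of _ 0])
  with mu(3) pos show ?thesis by (simp add: tan_def field_simps)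
qed

text \<open>The candidate may lie anywhere in [0,1). There the sine is nonnegative, so the equation
  forces \<open>cos (\<mu> * pi) >= 0\<close>, which brings \<mu> into the range of
  \<open>mu_unique_root\<close> or, for \<open>a = 0\<close>, to 1/2.\<close>

lemma mu_eqI:
  assumes a: "a \<noteq> \<infinity>" and n: "1 \<le> n" and \<mu>: "0 \<le> \<mu>" "\<mu> < 1"
    and root: "(real n - \<mu>) * pi * cos (\<mu> * pi) = enn2real a * sin (\<mu> * pi)"
  shows "mu a n = \<mu>"
proof -
  have npos: "(real n - \<mu>) * pi > 0" using n \<mu> by simp
  have \<mu>pi: "0 \<le> \<mu> * pi" "\<mu> * pi < pi" using \<mu> by auto
  have sc: "sin (\<mu> * pi) \<ge> 0" using \<mu>pi by (intro sin_ge_zero) auto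
  show ?thesis
  proof (cases "a = 0")
    case True
    then have "(real n - \<mu>) * pi * cos (\<mu> * pi) = 0" using root by simp
    then have "cos (\<mu> * pi) = cos (pi / 2)"
      unfolding mult_eq_0_iff[of "(real n - \<mu>) * pi"] cos_pi_half using npos by linarith
    then have "\<mu> * pi = pi / 2" using cos_inj_pi[of "\<mu> * pi" "pi / 2"] \<mu>pi by linarith
    then show ?thesis using True by (simp add: mu_def)
  next
    case False
    note pos = enn2real_pos[OF a False]
    have "(real n - \<mu>) * pi * cos (\<mu> * pi) \<ge> 0" using root pos sc by simp
    then have "cos (\<mu> * pi) \<ge> 0" using npos by (simp add: zero_le_mult_iff)
    moreover have "cos (\<mu> * pi) \<noteq> 0"
    proof
      assume c: "cos (\<mu> * pi) = 0"
      then have "sin (\<mu> * pi) = 0" using root pos by simp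
      with c show False using sin_cos_squared_add[of "\<mu> * pi"] by simp
    qed
    ultimately have c: "cos (\<mu> * pi) > 0" by simp
    have "\<mu> < 1/2"
    proof (rule ccontr)
      assume "\<not> \<mu> < 1/2"
      then have "cos (\<mu> * pi) \<le> cos (pi / 2)" using \<mu>pi by (intro cos_monotone_0_pi_le) auto
      with c show False by simp
    qed
    moreover have "0 < \<mu>"
    proof (rule ccontr)
      assume "\<not> 0 < \<mu>"
      with \<mu> have "\<mu> = 0" by simp
      with root n show False by simp
    qed
    moreover have "tan (\<mu> * pi) + \<mu> * pi / enn2real a = real n * pi / enn2real a"
      using root c pos by (simp add: tan_def field_simps)
    ultimately show ?thesis
      using the1_equality[OF mu_unique_root[OF pos n], of \<mu>] a False by (simp add: mu_def)
  qed
qed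

lemma robin_frequency_exists:
  assumes a: "a \<noteq> \<infinity>" and x: "x > 0" and root: "x * cos x + enn2real a * sin x = 0"
  shows "\<exists>n. x = (real (Suc n) - mu a (Suc n)) * pi"
proof -
  \<comment> \<open>Rounding up places the offset \<open>n - x / pi\<close> in [0,1), as
    \<open>mu_eqI\<close> requires.\<close>
  define n where "n = nat \<lceil>x / pi\<rceil>"
  have "x / pi > 0" using x by simp
  then have "\<lceil>x / pi\<rceil> \<ge> 1" by (simp only: one_le_ceiling)
  then have n: "1 \<le> n" "real n = of_int \<lceil>x / pi\<rceil>" unfolding n_def by linarith+
  define \<mu> where "\<mu> = real n - x / pi"
  have xe: "x = (real n - \<mu>) * pi" by (simp add: \<mu>_def)
  have \<mu>: "0 \<le> \<mu>" "\<mu> < 1" unfolding \<mu>_def n(2) by linarith+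
  have "mu a n = \<mu>"
    using root robin_frequency_iff[of n \<mu> "enn2real a"] unfolding xe[symmetric]
    by (intro mu_eqI[OF a n(1) \<mu>]) (auto simp: xe)
  with xe n(1) show ?thesis by (intro exI[of _ "n - 1"]) simp
qed

text \<open>
  \<open>\<beta> w'(1) + \<alpha> w(1) = 0\<close> covers the Dirichlet case by \<open>(\<alpha>, \<beta>) = (1, 0)\<close>. The index \<open>n\<close> of \<open>\<omega>\<close> starts
  at \<open>0\<close>, that of \<open>mu\<close> at \<open>1\<close>.
\<close>

definition robin_\<alpha> :: "ennreal \<Rightarrow> real" where "robin_\<alpha> a = (if a = \<infinity> then 1 else enn2real a)"
definition robin_\<beta> :: "ennreal \<Rightarrow> real" where "robin_\<beta> a = (if a = \<infinity> then 0 else 1)"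
definition robin_\<omega> :: "ennreal \<Rightarrow> nat \<Rightarrow> real" where
  "robin_\<omega> a n = (real (Suc n) - mu a (Suc n)) * pi"

text \<open>Completeness comes from \<open>sine_system_total\<close> in the Dirichlet case, and
  otherwise from \<open>robin_system_total\<close>, since every positive root is some
  \<open>robin_\<omega> a n\<close>.\<close>

lemma robin_system_mu: "robin_system (robin_\<alpha> a) (robin_\<beta> a) (robin_\<omega> a)"
proof
  show "0 \<le> robin_\<alpha> a" "0 \<le> robin_\<beta> a" "0 < robin_\<alpha> a + robin_\<beta> a"
    by (auto simp: robin_\<alpha>_def robin_\<beta>_def add_nonneg_pos)
  show "(real n + 1/2) * pi \<le> robin_\<omega> a n" "robin_\<omega> a n \<le> (real n + 1) * pi" for n
    unfolding robin_\<omega>_def using mu_bounds[of "Suc n" a] by (auto intro!: mult_right_mono)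
  show "robin_\<beta> a * (robin_\<omega> a n * cos (robin_\<omega> a n)) + robin_\<alpha> a * sin (robin_\<omega> a n) = 0" for n
  proof (cases "a = \<infinity>")
    case True
    then show ?thesis
      using sin_npi[of "Suc n"] by (simp add: robin_\<alpha>_def robin_\<beta>_def robin_\<omega>_def mu_def del: of_nat_Suc)
  next
    case False
    then show ?thesis
      using mu_root[OF False, of "Suc n"] robin_frequency_iff[of "Suc n" "mu a (Suc n)" "enn2real a"]
      by (simp add: robin_\<alpha>_def robin_\<beta>_def robin_\<omega>_def del: of_nat_Suc)
  qed
  fix f :: "real \<Rightarrow> real" and z :: real
  assume f: "continuous_on {0..1} f" and orth: "\<And>n. sin_coef f (robin_\<omega> a n) = 0" and z: "z \<in> {0..1}"
  show "f z = 0"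
  proof (cases "a = \<infinity>")
    case True
    show ?thesis
    proof (rule sine_system_total[OF f _ z])
      fix n
      show "integral {0..1} (\<lambda>s. f s * sin (real n * pi * s)) = 0"
      proof (cases n)
        case (Suc m)
        then show ?thesis using orth[of m] True by (simp add: sin_coef_def robin_\<omega>_def mu_def del: of_nat_Suc)
      qed simp
    qed
  next
    case False
    show ?thesis
    proof (rule robin_system_total[OF f _ _ z])
      fix x :: real
      assume "x > 0" "x * cos x + enn2real a * sin x = 0"
      from robin_frequency_exists[OF False this] orth
      show "integral {0..1} (\<lambda>s. f s * sin (x * s)) = 0"
        by (auto simp: sin_coef_def robin_\<omega>_def)
    qed simp
  qed
qed

section \<open>Passing between \<open>y\<close> and the weighted function \<open>w\<close>\<close>

lemma C2_triple_exp_weight: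
  assumes "C2_triple f f' f''"
  shows "C2_triple (\<lambda>z. exp (m * z) * f z) (\<lambda>z. exp (m * z) * (f' z + m * f z))
     (\<lambda>z. exp (m * z) * (f'' z + 2 * m * f' z + m^2 * f z))"
  using assms C2_triple_continuous[OF assms] unfolding C2_triple_def
  by (auto intro!: derivative_eq_intros continuous_intros simp: algebra_simps power2_eq_square)

lemma C2_triple_deriv:
  assumes f: "C2_triple f f' f''" and z: "z \<in> {0<..<1}"
  shows "deriv f z = f' z" "deriv (deriv f) z = f'' z"
proof -
  have at: "at z within {0..1} = at z" if "z \<in> {0<..<1}" for z :: real
    using that by (simp add: at_within_Icc_at)
  have 1: "deriv f z = f' z" if "z \<in> {0<..<1}" for z
  proof (rule DERIV_imp_deriv)
    have "(f has_real_derivative f' z) (at z within {0..1})" using f that by (simp add: C2_triple_def)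
    then show "(f has_real_derivative f' z) (at z)" unfolding at[OF that] .
  qed
  show "deriv f z = f' z" by (rule 1[OF z])
  have "\<forall>\<^sub>F x in nhds z. x \<in> {0<..<1}" using z by (intro eventually_nhds_in_open) auto
  then have "\<forall>\<^sub>F x in nhds z. deriv f x = f' x" by eventually_elim (rule 1)
  then have "deriv (deriv f) z = deriv f' z" by (intro deriv_cong_ev) auto
  also have "\<dots> = f'' z"
  proof (rule DERIV_imp_deriv)
    have "(f' has_real_derivative f'' z) (at z within {0..1})" using f z by (simp add: C2_triple_def)
    then show "(f' has_real_derivative f'' z) (at z)" unfolding at[OF z] .
  qed
  finally show "deriv (deriv f) z = f'' z" .
qed

lemma C2_triple_derivative_at_1:
  assumes f: "C2_triple f f' f''"
  shows "(f has_real_derivative c) (at 1 within {0..1}) \<longleftrightarrow> f' 1 = c"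
proof -
  have f1: "(f has_real_derivative f' 1) (at 1 within {0..1})" using f by (simp add: C2_triple_def)
  show ?thesis
    using vector_derivative_unique_within_closed_interval[of 0 1 1 f "f' 1" c] f1
    by (auto simp: has_real_derivative_iff_has_vector_derivative)
qed

text \<open>Differentiating the weight contributes \<open>m * f 1\<close>, which absorbs the term
  \<open>v / (2 * D)\<close> of the Robin condition; the positive factor \<open>exp m\<close> drops
  out.\<close>

lemma right_boundary_condition_weighted:
  assumes f: "C2_triple f f' f''" and m: "m = - (v / (2 * D))"
  shows "right_boundary_condition D v a f \<longleftrightarrow>
    robin_\<beta> a * (exp (m * 1) * (f' 1 + m * f 1)) + robin_\<alpha> a * (exp (m * 1) * f 1) = 0"
proof (cases "a = \<infinity>")
  case False
  have "robin_\<beta> a * (exp (m * 1) * (f' 1 + m * f 1)) + robin_\<alpha> a * (exp (m * 1) * f 1)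
     = exp m * (f' 1 - (v / (2 * D) - enn2real a) * f 1)"
    using False by (simp add: robin_\<alpha>_def robin_\<beta>_def m algebra_simps)
  then show ?thesis
    using False unfolding right_boundary_condition_def C2_triple_derivative_at_1[OF f] by simp
qed (simp add: right_boundary_condition_def robin_\<alpha>_def robin_\<beta>_def)

lemma G_eq: "G \<zeta> a = sqrt (\<Sum>n. (robin_\<omega> a n / (\<zeta>^2 + (robin_\<omega> a n)^2))^2 / robin_system.N (robin_\<omega> a) n)"
proof -
  interpret robin_system "robin_\<alpha> a" "robin_\<beta> a" "robin_\<omega> a" by (rule robin_system_mu)
  have "(robin_\<omega> a n / (\<zeta>^2 + (robin_\<omega> a n)^2))^2 / N n = 2 / pi^2 * G_term \<zeta> a (Suc n)" for n
  proof -
    define m where "m = real (Suc n) - mu a (Suc n)"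
    define s where "s = sin (2 * mu a (Suc n) * pi) / (2 * pi)"
    define Q where "Q = \<zeta>^2 / pi^2 + m^2"
    have m: "m > 0" using mu_bounds[of "Suc n" a] by (auto simp: m_def)
    have Q: "Q > 0" using m by (auto simp: Q_def intro: add_nonneg_pos)
    have \<omega>m: "robin_\<omega> a n = m * pi" by (simp add: robin_\<omega>_def m_def)
    \<comment> \<open>For \<open>a = \<infinity>\<close> one has \<open>s = 0\<close>, and the
      general formula collapses to the Dirichlet branch of \<open>G_term\<close>.\<close>
    have G: "G_term \<zeta> a (Suc n) = m^3 / ((m + s) * Q^2)"
    proof (cases "a = \<infinity>")
      case True
      then have "m = real (Suc n)" "s = 0" by (auto simp: m_def s_def mu_def)
      with True m show ?thesis
        by (simp add: G_term_def Q_def power2_eq_square power3_eq_cube del: of_nat_Suc)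
    next
      case False
      then show ?thesis by (simp add: G_term_def m_def s_def Q_def)
    qed
    \<comment> \<open>Reflection about a multiple of 2 pi flips the sign, which is why the sine
      enters \<open>G_term\<close> with a plus although \<open>N_eq\<close> has a minus.\<close>
    have "sin (2 * (m * pi)) = sin (real (Suc n) * (2 * pi) - 2 * mu a (Suc n) * pi)"
      by (simp add: m_def algebra_simps)
    also have "\<dots> = - sin (2 * mu a (Suc n) * pi)"
      using sin_npi[of "2 * Suc n"] cos_npi[of "2 * Suc n"]
      by (simp only: sin_diff of_nat_mult mult.assoc[of _ _ pi] mult.left_commute[of "real (Suc n)"]) simp
    finally have "N n = 1/2 + s / (2 * m)" using m by (simp add: N_eq \<omega>m s_def)
    then have Nm: "N n = (m + s) / (2 * m)" using m by (simp add: field_simps)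
    have ms: "m + s > 0" using N_pos[of n] m by (simp add: Nm zero_less_divide_iff)
    have "\<zeta>^2 + (m * pi)^2 = pi^2 * Q" by (simp add: Q_def field_simps)
    then have "m * pi / (\<zeta>^2 + (m * pi)^2) = m / (pi * Q)" by (simp add: power2_eq_square)
    then show ?thesis
      using m ms Q unfolding \<omega>m G Nm
      by (simp add: power_divide power_mult_distrib power2_eq_square power3_eq_cube mult_ac)
  qed
  then have "(\<Sum>n. (robin_\<omega> a n / (\<zeta>^2 + (robin_\<omega> a n)^2))^2 / N n) = 2 / pi^2 * (\<Sum>n. G_term \<zeta> a (Suc n))"
    by (simp only: suminf_mult[OF summable_G_term])
  then show ?thesis by (simp add: G_def real_sqrt_mult real_sqrt_divide)
qed

text \<open>This \<open>m\<close> satisfies \<open>2 * D * m = - v\<close>, so the weight removes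
  the convection term and moves its effect into \<zeta>.\<close>

lemma is_solution_imp_heat_solution:
  assumes sol: "is_solution D v k a d y0 y" and D: "D > 0" and m: "m = - (v / (2 * D))"
    and d: "\<And>t. t \<ge> 0 \<Longrightarrow> y t 0 = d t" and \<zeta>: "\<zeta>^2 = m^2 + k / D"
  shows "robin_system.heat_solution (robin_\<alpha> a) (robin_\<beta> a) D \<zeta> d (\<lambda>t z. exp (m * z) * y t z)"
proof -
  interpret robin_system "robin_\<alpha> a" "robin_\<beta> a" "robin_\<omega> a" by (rule robin_system_mu)
  from sol have cont: "continuous_on ({0..} \<times> {0..1}) (\<lambda>(t, z). y t z)"
    and C1: "C1_on_Times {0<..} {0..1} y" and C2: "\<And>t. t \<ge> 0 \<Longrightarrow> C2_on {0..1} (y t)"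
    and pde: "\<And>t z. t > 0 \<Longrightarrow> z \<in> {0<..<1} \<Longrightarrow>
        deriv (\<lambda>s. y s z) t = D * deriv (deriv (y t)) z - v * deriv (y t) z - k * y t z"
    and bc: "\<And>t. t \<ge> 0 \<Longrightarrow> right_boundary_condition D v a (y t)"
    by (auto simp: is_solution_def)
  obtain yt where
    yt: "\<And>t z. t > 0 \<Longrightarrow> z \<in> {0..1} \<Longrightarrow> ((\<lambda>s. y s z) has_real_derivative yt t z) (at t)"
    and cyt: "continuous_on ({0<..} \<times> {0..1}) (\<lambda>(t, z). yt t z)"
    using C1 unfolding C1_on_Times_def by (metis at_within_open greaterThan_iff open_greaterThan)
  show ?thesis
    unfolding heat_solution_def
  proof (intro conjI exI[of _ "\<lambda>t z. exp (m * z) * yt t z"] allI impI ballI)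
    show "continuous_on ({0..} \<times> {0..1}) (\<lambda>(t, z). exp (m * z) * y t z)"
      using cont unfolding split_beta by (intro continuous_intros)
    show "continuous_on ({0<..} \<times> {0..1}) (\<lambda>(t, z). exp (m * z) * yt t z)"
      using cyt unfolding split_beta by (intro continuous_intros)
    show "((\<lambda>s. exp (m * z) * y s z) has_real_derivative exp (m * z) * yt t z) (at t)"
      if "0 < t" "z \<in> {0..1}" for t z
      by (intro DERIV_cmult yt that)
  next
    fix t :: real assume t: "0 \<le> t"
    obtain y' y'' where y': "C2_triple (y t) y' y''"
      using C2[OF t] unfolding C2_on_def C2_triple_def by blast
    define w' where "w' = (\<lambda>z. exp (m * z) * (y' z + m * y t z))"
    define w'' where "w'' = (\<lambda>z. exp (m * z) * (y'' z + 2 * m * y' z + m^2 * y t z))"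
    have "C2_triple (\<lambda>z. exp (m * z) * y t z) w' w''"
      unfolding w'_def w''_def by (rule C2_triple_exp_weight[OF y'])
    moreover have "bc (\<lambda>z. exp (m * z) * y t z) w'"
      using right_boundary_condition_weighted[OF y' m] bc[OF t] by (simp add: bc_def w'_def)
    moreover have "exp (m * z) * yt t z = D * (w'' z - \<zeta>^2 * (exp (m * z) * y t z))"
      if t: "t > 0" and z: "z \<in> {0<..<1}" for z
    proof -
      have "yt t z = deriv (\<lambda>s. y s z) t" using yt[OF t, of z] z by (simp add: DERIV_imp_deriv)
      also have "\<dots> = D * y'' z - v * y' z - k * y t z"
        using pde[OF t z] C2_triple_deriv[OF y' z] by simp
      also have "\<dots> = D * (y'' z + 2 * m * y' z + m^2 * y t z - \<zeta>^2 * y t z)"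
        using D by (simp add: \<zeta> m field_simps)
      finally have "exp (m * z) * yt t z
          = exp (m * z) * (D * (y'' z + 2 * m * y' z + m^2 * y t z - \<zeta>^2 * y t z))" by simp
      then show ?thesis by (simp add: w''_def algebra_simps)
    qed
    ultimately show "\<exists>w' w''. C2_triple (\<lambda>z. exp (m * z) * y t z) w' w'' \<and>
        bc (\<lambda>z. exp (m * z) * y t z) w' \<and>
        (0 < t \<longrightarrow> (\<forall>z\<in>{0<..<1}. exp (m * z) * yt t z = D * (w'' z - \<zeta>^2 * (exp (m * z) * y t z))))"
      by blast
  qed (use d in simp)
qed

lemma heat_solution_imp_is_solution:
  assumes sol: "robin_system.heat_solution (robin_\<alpha> a) (robin_\<beta> a) D \<zeta> d w"
    and wz: "\<And>t z. t > 0 \<Longrightarrow> z \<in> {0..1} \<Longrightarrow> (w t has_real_derivative wz t z) (at z within {0..1})"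
    and cwz: "continuous_on ({0<..} \<times> {0..1}) (\<lambda>(t, z). wz t z)"
    and init: "\<And>z. z \<in> {0..1} \<Longrightarrow> exp (m * z) * w 0 z = y0 z"
    and D: "D > 0" and m: "m = v / (2 * D)" and \<zeta>: "\<zeta>^2 = m^2 + k / D"
  shows "is_solution D v k a d y0 (\<lambda>t z. exp (m * z) * w t z)"
proof -
  interpret robin_system "robin_\<alpha> a" "robin_\<beta> a" "robin_\<omega> a" by (rule robin_system_mu)
  from sol obtain wt where
    cont: "continuous_on ({0..} \<times> {0..1}) (\<lambda>(t, z). w t z)" and
    wt: "\<And>t z. t > 0 \<Longrightarrow> z \<in> {0..1} \<Longrightarrow> ((\<lambda>s. w s z) has_real_derivative wt t z) (at t)"
    and cwt: "continuous_on ({0<..} \<times> {0..1}) (\<lambda>(t, z). wt t z)"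
    and pde: "\<And>t. t \<ge> 0 \<Longrightarrow> \<exists>w' w''. C2_triple (w t) w' w'' \<and> bc (w t) w' \<and>
            (0 < t \<longrightarrow> (\<forall>z\<in>{0<..<1}. wt t z = D * (w'' z - \<zeta>^2 * w t z)))"
    and d: "\<And>t. t \<ge> 0 \<Longrightarrow> w t 0 = d t"
    unfolding heat_solution_def by blast
  have y: "\<exists>y' y''. C2_triple (\<lambda>z. exp (m * z) * w t z) y' y'' \<and>
      right_boundary_condition D v a (\<lambda>z. exp (m * z) * w t z) \<and>
      (0 < t \<longrightarrow> (\<forall>z\<in>{0<..<1}. exp (m * z) * wt t z = D * y'' z - v * y' z - k * (exp (m * z) * w t z)))"
    if t: "t \<ge> 0" for t
  proof -
    obtain w' w'' where w': "C2_triple (w t) w' w''" "bc (w t) w'"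
      "\<And>z. 0 < t \<Longrightarrow> z \<in> {0<..<1} \<Longrightarrow> wt t z = D * (w'' z - \<zeta>^2 * w t z)"
      using pde[OF t] by blast
    define y' where "y' = (\<lambda>z. exp (m * z) * (w' z + m * w t z))"
    define y'' where "y'' = (\<lambda>z. exp (m * z) * (w'' z + 2 * m * w' z + m^2 * w t z))"
    have C2: "C2_triple (\<lambda>z. exp (m * z) * w t z) y' y''"
      unfolding y'_def y''_def by (rule C2_triple_exp_weight[OF w'(1)])
    \<comment> \<open>The boundary lemma is applied to \<open>y\<close> with the inverse weight,
      which gives back \<open>w\<close> and its derivative at 1.\<close>
    have "- m = - (v / (2 * D))" by (simp add: m)
    note weighted = right_boundary_condition_weighted[OF C2 this, of a]
    have "exp (- m * 1) * (y' 1 + - m * (exp (m * 1) * w t 1)) = w' 1"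
      "exp (- m * 1) * (exp (m * 1) * w t 1) = w t 1"
      by (simp_all add: y'_def exp_minus field_simps)
    with weighted w'(2) have "right_boundary_condition D v a (\<lambda>z. exp (m * z) * w t z)"
      by (simp only: bc_def)
    moreover have "exp (m * z) * wt t z = D * y'' z - v * y' z - k * (exp (m * z) * w t z)"
      if t: "0 < t" and z: "z \<in> {0<..<1}" for z
    proof -
      have "D * y'' z - v * y' z - k * (exp (m * z) * w t z) =
         exp (m * z) * (D * (w'' z + 2 * m * w' z + m^2 * w t z) - v * (w' z + m * w t z) - k * w t z)"
        by (simp add: y'_def y''_def algebra_simps)
      also have "D * (w'' z + 2 * m * w' z + m^2 * w t z) - v * (w' z + m * w t z) - k * w t z
         = D * (w'' z - \<zeta>^2 * w t z)"
      proof -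
        have vk: "v = 2 * D * m" "k = D * (\<zeta>^2 - m^2)" using D by (simp_all add: \<zeta> m)
        show ?thesis unfolding vk by (simp add: algebra_simps power2_eq_square)
      qed
      finally show ?thesis using w'(3)[OF t z] by simp
    qed
    ultimately show ?thesis using C2 by blast
  qed
  show ?thesis
    unfolding is_solution_def
  proof (intro conjI allI impI ballI)
    show "continuous_on ({0..} \<times> {0..1}) (\<lambda>(t, z). exp (m * z) * w t z)"
      using cont unfolding split_beta by (intro continuous_intros)
    show "C1_on_Times {0<..} {0..1} (\<lambda>t z. exp (m * z) * w t z)"
      unfolding C1_on_Times_def
    proof (rule exI[of _ "\<lambda>t z. exp (m * z) * wt t z"],
        rule exI[of _ "\<lambda>t z. exp (m * z) * (wz t z + m * w t z)"], intro conjI ballI)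
      fix t z :: real assume t: "t \<in> {0<..}" and z: "z \<in> {0..1}"
      have "((\<lambda>s. exp (m * z) * w s z) has_real_derivative exp (m * z) * wt t z) (at t)"
        using t z by (intro DERIV_cmult wt) auto
      then show "((\<lambda>s. exp (m * z) * w s z) has_real_derivative exp (m * z) * wt t z) (at t within {0<..})"
        by (rule DERIV_subset) simp
      show "((\<lambda>z. exp (m * z) * w t z) has_real_derivative exp (m * z) * (wz t z + m * w t z)) (at z within {0..1})"
        using wz[of t z] t z by (auto intro!: derivative_eq_intros simp: algebra_simps)
    next
      show "continuous_on ({0<..} \<times> {0..1}) (\<lambda>(t, z). exp (m * z) * wt t z)"
        using cwt unfolding split_beta by (intro continuous_intros)
      have "continuous_on ({0<..} \<times> {0..1}) (\<lambda>x. w (fst x) (snd x))"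
        using cont unfolding split_beta by (rule continuous_on_subset) auto
      then show "continuous_on ({0<..} \<times> {0..1}) (\<lambda>(t, z). exp (m * z) * (wz t z + m * w t z))"
        using cwz unfolding split_beta by (intro continuous_intros)
    qed
    show "C2_on {0..1} (\<lambda>z. exp (m * z) * w t z)" if "0 \<le> t" for t
      using y[OF that] unfolding C2_on_def C2_triple_def by blast
    show "deriv (\<lambda>s. exp (m * z) * w s z) t =
        D * deriv (deriv (\<lambda>z. exp (m * z) * w t z)) z - v * deriv (\<lambda>z. exp (m * z) * w t z) z -
        k * (exp (m * z) * w t z)" if t: "0 < t" and z: "z \<in> {0<..<1}" for t z
    proof -
      obtain y' y'' where y': "C2_triple (\<lambda>z. exp (m * z) * w t z) y' y''"
         "exp (m * z) * wt t z = D * y'' z - v * y' z - k * (exp (m * z) * w t z)"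
        using y[of t] t z by auto
      have "deriv (\<lambda>s. exp (m * z) * w s z) t = exp (m * z) * wt t z"
        using t z by (intro DERIV_imp_deriv DERIV_cmult wt) auto
      then show ?thesis using y'(2) C2_triple_deriv[OF y'(1) z] by simp
    qed
    show "exp (m * 0) * w t 0 = d t" if "0 \<le> t" for t using d[OF that] by simp
    show "right_boundary_condition D v a (\<lambda>z. exp (m * z) * w t z)" if "0 \<le> t" for t
      using y[OF that] by blast
    show "exp (m * z) * w 0 z = y0 z" if "z \<in> {0..1}" for z by (rule init[OF that])
  qed
qed

section \<open>Existence, uniqueness and the estimate for the original equation\<close>

theorem corollary4p1:
  fixes D v k \<zeta> :: real and a :: ennreal and d y0 :: "real \<Rightarrow> real"
  assumes "D > 0" and "v \<ge> 0" and "k > - (v^2 / (4 * D))"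
    and "\<zeta> = 1 / (2 * D) * sqrt (v^2 + 4 * k * D)"
    and "C2_on {0..} d" and "C2_on {0..1} y0"
    and "y0 0 = d 0" and "right_boundary_condition D v a y0"
  shows "(\<exists>y. is_solution D v k a d y0 y) \<and>
    (\<forall>y1 y2. is_solution D v k a d y0 y1 \<and> is_solution D v k a d y0 y2 \<longrightarrow>
       (\<forall>t\<ge>0. \<forall>z\<in>{0..1}. y1 t z = y2 t z)) \<and>
    (\<forall>y. is_solution D v k a d y0 y \<longrightarrow>
       (\<forall>t\<ge>0. \<forall>\<epsilon>>0.
          sqrt (integral {0..1} (\<lambda>z. exp (- (v * z / D)) * (y t z)^2))
          \<le> exp (- D * (\<zeta>^2 + pi^2 * (1 - mu a 1)^2) * t) *
              sqrt ((1 + \<epsilon>) * integral {0..1} (\<lambda>z. exp (- (v * z / D)) * (y0 z)^2))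
            + sqrt (1 + 1 / \<epsilon>) * G \<zeta> a * (SUP s\<in>{0..t}. \<bar>d s\<bar>)))"
proof -
  interpret robin_system "robin_\<alpha> a" "robin_\<beta> a" "robin_\<omega> a" by (rule robin_system_mu)
  define m where "m = v / (2 * D)"
  \<comment> \<open>The lower bound on \<open>k\<close> is exactly positivity of the radicand, hence
    \<zeta> > 0.\<close>
  have "v^2 + 4 * k * D > 0" using assms(1,3) by (simp add: field_simps)
  then have \<zeta>: "\<zeta> > 0" and "\<zeta>^2 = (v^2 + 4 * k * D) / (2 * D)^2"
    using assms(1,4) by (auto simp: power_divide)
  then have \<zeta>2: "\<zeta>^2 = m^2 + k / D"
    using assms(1) by (simp add: m_def field_simps power2_eq_square)
  have m_neg: "- m = - (v / (2 * D))" by (simp add: m_def)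
  have heat: "heat_solution D \<zeta> d (\<lambda>t z. exp (- m * z) * y t z)" if "is_solution D v k a d y0 y" for y
    using that \<zeta>2
    by (intro is_solution_imp_heat_solution[OF that assms(1) m_neg]) (auto simp: is_solution_def)
  have init: "y 0 z = y0 z" if "is_solution D v k a d y0 y" "z \<in> {0..1}" for y z
    using that by (simp add: is_solution_def)
  obtain d' d'' where d': "\<And>t. t \<ge> 0 \<Longrightarrow> (d has_real_derivative d' t) (at t within {0..})"
    and d'': "\<And>t. t \<ge> 0 \<Longrightarrow> (d' has_real_derivative d'' t) (at t within {0..})" "continuous_on {0..} d''"
    using assms(5) unfolding C2_on_def by auto
  have "\<exists>y. is_solution D v k a d y0 y"
  proof -
    obtain y0' y0'' where y0: "C2_triple y0 y0' y0''"
      using assms(6) unfolding C2_on_def C2_triple_def by blast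
    have "bc (\<lambda>z. exp (- m * z) * y0 z) (\<lambda>z. exp (- m * z) * (y0' z + - m * y0 z))"
      using right_boundary_condition_weighted[OF y0 m_neg, of a] assms(8) unfolding bc_def by blast
    then obtain w wz where w: "heat_solution D \<zeta> d w" "\<And>z. z \<in> {0..1} \<Longrightarrow> w 0 z = exp (- m * z) * y0 z"
      "\<And>t z. t > 0 \<Longrightarrow> z \<in> {0..1} \<Longrightarrow> (w t has_real_derivative wz t z) (at z within {0..1})"
      "continuous_on ({0<..} \<times> {0..1}) (\<lambda>(t, z). wz t z)"
      using heat_solution_exists[OF assms(1) \<zeta> d' d'' C2_triple_exp_weight[OF y0, of "- m"]] assms(7)
      by auto
    have "exp (m * z) * w 0 z = y0 z" if "z \<in> {0..1}" for z
      using w(2)[OF that] by (simp add: exp_minus)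
    from heat_solution_imp_is_solution[OF w(1,3,4) this assms(1) m_def \<zeta>2] show ?thesis by blast
  qed
  moreover have "y1 t z = y2 t z"
    if y: "is_solution D v k a d y0 y1" "is_solution D v k a d y0 y2" and t: "t \<ge> 0" and z: "z \<in> {0..1}"
    for y1 y2 t z
  proof -
    have "exp (- m * z) * y1 t z = exp (- m * z) * y2 t z"
      using init[OF y(1)] init[OF y(2)] by (intro heat_solution_unique[OF heat heat _ t z] y) simp
    then show ?thesis by simp
  qed
  moreover have "sqrt (integral {0..1} (\<lambda>z. exp (- (v * z / D)) * (y t z)^2))
          \<le> exp (- D * (\<zeta>^2 + pi^2 * (1 - mu a 1)^2) * t) *
              sqrt ((1 + \<epsilon>) * integral {0..1} (\<lambda>z. exp (- (v * z / D)) * (y0 z)^2))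
            + sqrt (1 + 1 / \<epsilon>) * G \<zeta> a * (SUP s\<in>{0..t}. \<bar>d s\<bar>)"
    if y: "is_solution D v k a d y0 y" and t: "t \<ge> 0" and \<epsilon>: "\<epsilon> > 0" for y t \<epsilon>
  proof -
    \<comment> \<open>Squaring the weight turns the plain norm of \<open>w\<close> into the weighted
      norm of \<open>y\<close>.\<close>
    have weight: "(exp (- m * z) * x)^2 = exp (- (v * z / D)) * x^2" for x z
      using assms(1) by (simp add: power_mult_distrib m_def field_simps flip: exp_double)
    have "continuous_on {0..} d" by (rule DERIV_continuous_on) (use d' in auto)
    then have "continuous_on {0..t} d" by (rule continuous_on_subset) auto
    from continuous_on_Icc_bound[OF this] obtain B where "\<And>s. s \<in> {0..t} \<Longrightarrow> \<bar>d s\<bar> \<le> B" by blast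
    \<comment> \<open>Boundedness is what makes the supremum over [0,t] an upper bound of
      |d|.\<close>
    then have "bdd_above ((\<lambda>s. \<bar>d s\<bar>) ` {0..t})" by (intro bdd_aboveI[of _ B]) auto
    then have "\<bar>d s\<bar> \<le> (SUP s\<in>{0..t}. \<bar>d s\<bar>)" if "s \<in> {0..t}" for s
      using that by (intro cSUP_upper)
    note est = heat_solution_estimate[OF heat[OF y] assms(1) t \<epsilon> this]
    have "integral {0..1} (\<lambda>z. exp (- (v * z / D)) * (y 0 z)^2) = integral {0..1} (\<lambda>z. exp (- (v * z / D)) * (y0 z)^2)"
      by (intro integral_cong) (simp add: init[OF y])
    moreover have "(robin_\<omega> a 0)^2 = pi^2 * (1 - mu a 1)^2"
      by (simp add: robin_\<omega>_def power_mult_distrib)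
    ultimately show ?thesis using est unfolding weight G_eq by simp
  qed
  ultimately show ?thesis by blast
qed

end
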